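(* Let $X$ be a closed subscheme of $\mathbb{P}^n$. If $M(X)<G(X)$, then $M(X)=1$.
   Context: $k$ is an algebraically closed field of characteristic $0$, $R=k[x_0,\dots,x_n]$, $\mathbb{P}^n=\operatorname{Proj}R$. For a (nonempty) closed subscheme $X\subset\mathbb{P}^n$, $I_X\subset R$ is its saturated homogeneous ideal, $H_X(d)=\dim_k(R/I_X)_d$ is its Hilbert function, and $\Delta H_X(d)=H_X(d)-H_X(d-1)$. For integers $c,d>0$ the $d$-binomial expansion of $c$ is the unique expression $c=\binom{k_d}{d}+\binom{k_{d-1}}{d-1}+\cdots+\binom{k_\delta}{\delta}$ with $k_d>k_{d-1}>\cdots>k_\delta\geq\delta>0$. The $d$-th Macaulay difference set of $c$ is the tuple $M_d(c)=(k_d-d,\,k_{d-1}-(d-1),\dots,k_\delta-\delta)$; its length is its number of entries. Put $c_{\langle d\rangle}=\binom{k_d-1}{d}+\cdots+\binom{k_\delta-1}{\delta}$ (with $\binom ij=0$ if $i<j$). For $d\gg0$ the tuples $M_d(H_X(d))$ do not depend on $d$; this eventually constant tuple is the Gotzmann difference set of $X$, and its length is the Gotzmann number $G(X)$. $M(X)$ is the least integer $d\geq1$ such that $H(S_X/hS_X,t)=H_X(t)_{\langle t\rangle}$ for all $t\geq d$, where $S_X=R/I_X$, $h$ is a general linear form, and $H(A,t)=\dim_k A_t$; since $I_X$ is saturated, equivalently $M(X)=\min\{d\geq1 : \Delta H_X(t)=H_X(t)_{\langle t\rangle}\ \forall t\geq d\}$. *)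

theory Defs
  imports
    Complex_Main
    "HOL-Computational_Algebra.Polynomial"
    "HOL-Library.Poly_Mapping"
begin

text \<open>
  Polynomials in the variables $x_0, x_1, \dots$ are finitely supported functions from
  monomials (exponent vectors of type \<open>nat \<Rightarrow>\<^sub>0 nat\<close>) to coefficients; addition and multiplication
  are those of \<open>Poly_Mapping\<close>. The ring $R = k[x_0,\dots,x_n]$ is the subring
  \<open>polys n\<close> of polynomials in which only $x_0,\dots,x_n$ occur.
\<close>

type_synonym 'k mpoly = "(nat \<Rightarrow>\<^sub>0 nat) \<Rightarrow>\<^sub>0 'k"

definition polys :: "nat \<Rightarrow> 'k::zero mpoly set" where
  "polys n = {p. \<forall>m\<in>Poly_Mapping.keys p. Poly_Mapping.keys m \<subseteq> {..n}}"

definition mono_degree :: "(nat \<Rightarrow>\<^sub>0 nat) \<Rightarrow> nat" where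
  "mono_degree m = (\<Sum>i\<in>Poly_Mapping.keys m. Poly_Mapping.lookup m i)"

text \<open>The graded piece $R_t$.\<close>

definition homog :: "nat \<Rightarrow> nat \<Rightarrow> 'k::zero mpoly set" where
  "homog n t = {p \<in> polys n. \<forall>m\<in>Poly_Mapping.keys p. mono_degree m = t}"

definition homog_component :: "nat \<Rightarrow> 'k::comm_ring_1 mpoly \<Rightarrow> 'k mpoly" where
  "homog_component t p =
    (\<Sum>m\<in>{m \<in> Poly_Mapping.keys p. mono_degree m = t}.
      Poly_Mapping.single m (Poly_Mapping.lookup p m))"

definition poly_scale :: "'k::comm_ring_1 \<Rightarrow> 'k mpoly \<Rightarrow> 'k mpoly" where
  "poly_scale c p = Poly_Mapping.single 0 c * p"

global_interpretation poly_vs: vector_space "poly_scale :: 'k::field \<Rightarrow> 'k mpoly \<Rightarrow> 'k mpoly"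
  by standard
    (simp_all add: poly_scale_def algebra_simps single_add mult_single flip: mult.assoc)

definition eval_mpoly :: "'k::comm_ring_1 mpoly \<Rightarrow> (nat \<Rightarrow> 'k) \<Rightarrow> 'k" where
  "eval_mpoly p a =
    (\<Sum>m\<in>Poly_Mapping.keys p.
      Poly_Mapping.lookup p m * (\<Prod>i\<in>Poly_Mapping.keys m. a i ^ Poly_Mapping.lookup m i))"


definition ideal_in :: "nat \<Rightarrow> 'k::comm_ring_1 mpoly set \<Rightarrow> bool" where
  "ideal_in n I \<longleftrightarrow> I \<subseteq> polys n \<and> 0 \<in> I \<and> (\<forall>f\<in>I. \<forall>g\<in>I. f + g \<in> I) \<and>
    (\<forall>f\<in>I. \<forall>g\<in>polys n. g * f \<in> I)"

definition homogeneous_ideal :: "nat \<Rightarrow> 'k::comm_ring_1 mpoly set \<Rightarrow> bool" where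
  "homogeneous_ideal n I \<longleftrightarrow> ideal_in n I \<and> (\<forall>f\<in>I. \<forall>t. homog_component t f \<in> I)"

text \<open>
  $I$ is saturated if $f \in R$ and $\mathfrak m^N f \subseteq I$ for some $N$ imply $f \in I$, where
  $\mathfrak m = (x_0,\dots,x_n)$; the ideal $\mathfrak m^N$ is generated by $R_N$.
\<close>

definition saturated :: "nat \<Rightarrow> 'k::comm_ring_1 mpoly set \<Rightarrow> bool" where
  "saturated n I \<longleftrightarrow> (\<forall>f\<in>polys n. (\<exists>N. \<forall>g\<in>homog n N. g * f \<in> I) \<longrightarrow> f \<in> I)"

text \<open>
  The closed subschemes $X$ of $\mathbb P^n$ correspond bijectively to the saturated homogeneous
  ideals $I_X$ of $R$, and $X$ is represented here by $I_X$. The scheme $X$ is nonempty if and only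
  if $I_X \neq R$.
\<close>

definition nonempty_closed_subscheme :: "nat \<Rightarrow> 'k::comm_ring_1 mpoly set \<Rightarrow> bool" where
  "nonempty_closed_subscheme n I \<longleftrightarrow> homogeneous_ideal n I \<and> saturated n I \<and> I \<noteq> polys n"


text \<open>
  For a homogeneous ideal $J$, $\dim_k (R/J)_t = \dim_k R_t - \dim_k (J \cap R_t)$. The spaces on
  the right are finite-dimensional with $J \cap R_t \subseteq R_t$, so the subtraction on
  \<open>nat\<close> does not truncate.
\<close>

definition hilbert :: "nat \<Rightarrow> 'k::field mpoly set \<Rightarrow> nat \<Rightarrow> nat" where
  "hilbert n J t = poly_vs.dim (homog n t :: 'k mpoly set) - poly_vs.dim (J \<inter> homog n t)"

definition linear_form :: "nat \<Rightarrow> (nat \<Rightarrow> 'k::comm_ring_1) \<Rightarrow> 'k mpoly" where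
  "linear_form n a = (\<Sum>i\<le>n. Poly_Mapping.single (Poly_Mapping.single i 1) (a i))"

text \<open>
  A property holds for a general linear form $a_0 x_0 + \dots + a_n x_n$ if it holds on a nonempty
  Zariski-open set of coefficient vectors; such a set contains a nonempty principal open set
  $\{F \neq 0\}$, and $\{F \neq 0\}$ is nonempty for every nonzero $F$ since $k$ is infinite.
\<close>

definition for_general_linear_form :: "nat \<Rightarrow> ('k::comm_ring_1 mpoly \<Rightarrow> bool) \<Rightarrow> bool" where
  "for_general_linear_form n P \<longleftrightarrow>
    (\<exists>F\<in>polys n. F \<noteq> 0 \<and> (\<forall>a. eval_mpoly F a \<noteq> 0 \<longrightarrow> P (linear_form n a)))"

text \<open>$I + hR$, so that $S/hS = R/(I + hR)$ for $S = R/I$.\<close>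

definition add_principal :: "nat \<Rightarrow> 'k::comm_ring_1 mpoly set \<Rightarrow> 'k mpoly \<Rightarrow> 'k mpoly set" where
  "add_principal n I h = {f + g * h | f g. f \<in> I \<and> g \<in> polys n}"


text \<open>
  The list \<open>ks\<close> is $[k_d, k_{d-1}, \dots, k_\delta]$; thus \<open>ks ! j\<close> is $k_{d-j}$ and
  $\delta = d - (\mathit{length}\ ks - 1)$, which is positive since \<open>length ks \<le> d\<close>.
\<close>

definition is_binomial_expansion :: "nat \<Rightarrow> nat \<Rightarrow> nat list \<Rightarrow> bool" where
  "is_binomial_expansion d c ks \<longleftrightarrow>
    ks \<noteq> [] \<and> length ks \<le> d \<and> sorted_wrt (>) ks \<and> last ks \<ge> d - (length ks - 1) \<and>
    c = (\<Sum>j<length ks. (ks ! j) choose (d - j))"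

definition binomial_expansion :: "nat \<Rightarrow> nat \<Rightarrow> nat list" where
  "binomial_expansion d c = (THE ks. is_binomial_expansion d c ks)"

text \<open>$M_d(c)$, for $c, d > 0$; all differences $k_i - i$ are nonnegative.\<close>

definition macaulay_set :: "nat \<Rightarrow> nat \<Rightarrow> nat list" where
  "macaulay_set d c =
    (let ks = binomial_expansion d c in map (\<lambda>j. ks ! j - (d - j)) [0..<length ks])"

text \<open>$c_{\langle d\rangle}$, for $c, d > 0$; all $k_i$ are positive.\<close>

definition macaulay_lower :: "nat \<Rightarrow> nat \<Rightarrow> nat" where
  "macaulay_lower d c =
    (let ks = binomial_expansion d c in \<Sum>j<length ks. (ks ! j - 1) choose (d - j))"


definition gotzmann_set :: "nat \<Rightarrow> 'k::field mpoly set \<Rightarrow> nat list" where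
  "gotzmann_set n I = (THE T. \<forall>\<^sub>F d in sequentially. macaulay_set d (hilbert n I d) = T)"

definition gotzmann_number :: "nat \<Rightarrow> 'k::field mpoly set \<Rightarrow> nat" where
  "gotzmann_number n I = length (gotzmann_set n I)"

definition M_number :: "nat \<Rightarrow> 'k::field mpoly set \<Rightarrow> nat" where
  "M_number n I = (LEAST d. d \<ge> 1 \<and>
    for_general_linear_form n (\<lambda>h. \<forall>t\<ge>d.
      hilbert n (add_principal n I h) t = macaulay_lower t (hilbert n I t)))"

end

theory Submission
  imports Defs "HOL-Library.Multiset" "HOL-Library.FuncSet"
begin

text \<open>
  Green's hyperplane restriction theorem bounds $H(R/(J + hR), t)$ by $H(R/J, t)_{\langle t\rangle}$
  for general $h$, and restricting once yields Macaulay's bound in the form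
  $H(t) - H(t)_{\langle t\rangle} \le H(t-1)$. Hence the Macaulay difference sets of $H_X(t)$ decrease
  lexicographically and become constant. Then Green's bound in one large degree is attained in all
  larger degrees, so a general $h$ is a nonzerodivisor there, and by saturation in every degree.

  Let $m = M(X) < G(X)$. For $t \ge m$, $H_X(t-1) = H_X(t) - H_X(t)_{\langle t\rangle}$ is obtained by
  lowering the degree in the expansion of $H_X(t)$, so the difference set is constant from degree
  $G(X)$ on. In passing to degree $G(X) - 1$ it is too long by one and a carry occurs, after which
  all its entries are positive, and they remain so down to degree $m$. But then
  $H_X(m)_{\langle m\rangle}$ has the difference set with all entries lowered by one, and Macaulay's
  bound for $R/(I_X + hR)$ between $m - 1$ and $m$ shows that Green's bound is attained in
  degree $m - 1$. By minimality, $m = 1$.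
\<close>

section \<open>Macaulay expansions\<close>

text \<open>Two obstacles shape the proof. M(X) asks for one open set of linear forms that serves
  infinitely many degrees, while open conditions can be intersected only finitely often. So Green's
  theorem is applied in one degree at a time, and larger degrees are reached numerically: Macaulay's
  bound for the ideal I_X + hR itself carries the upper bound upward.

  The other obstacle is the behavior of expansions under a change of degree. By Pascal's rule, c -
  c_<d> is the difference set of c read in degree d - 1, so both bounds become comparisons of lists
  in adjacent degrees. The danger is a zero entry: in positive degree it adds nothing to c_<d>, but
  as the surplus last entry of a list of length d + 1 read in degree d it adds C(0, 0) = 1. Because
  of it, Green's upper and Macaulay's lower bound in degree M(X) - 1 could differ by 1; the
  hypothesis M(X) < G(X) excludes zero entries in degree M(X).

  Here and below, C(n, k) is a binomial coefficient.\<close>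

text \<open>
  Expansions are encoded by their Macaulay difference sets: the list $[a_0, a_1, \dots]$ stands for
  $\sum_j \binom{a_j + d - j}{d - j}$, and its length is at most $d$. Several lemmas also admit
  length $d + 1$, since this is what remains of an expansion when $d + 1$ is lowered to $d$.
\<close>

fun mval :: "nat \<Rightarrow> nat list \<Rightarrow> nat" where
  "mval d [] = 0"
| "mval d (a # as) = (a + d choose d) + mval (d - 1) as"

fun mlow :: "nat \<Rightarrow> nat list \<Rightarrow> nat" where
  "mlow d [] = 0"
| "mlow d (a # as) = (a + d - 1 choose d) + mlow (d - 1) as"

text \<open>A proper prefix counts as smaller, since a further entry adds at least 1 to
  \<open>mval\<close>.\<close>

fun lex_le :: "nat list \<Rightarrow> nat list \<Rightarrow> bool" where
  "lex_le [] bs \<longleftrightarrow> True"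
| "lex_le (a # as) [] \<longleftrightarrow> False"
| "lex_le (a # as) (b # bs) \<longleftrightarrow> a < b \<or> a = b \<and> lex_le as bs"

abbreviation desc :: "nat list \<Rightarrow> bool" where
  "desc \<equiv> sorted_wrt (\<ge>)"

lemma lex_le_antisym: "lex_le as bs \<Longrightarrow> lex_le bs as \<Longrightarrow> as = bs"
  by (induction as bs rule: lex_le.induct) (auto, (case_tac bs; simp)+)

lemma choose_Suc_step:
  assumes "d > 0"
  shows "(Suc a + d choose d) = (a + d choose d) + (Suc a + (d - 1) choose (d - 1))"
  using assms by (cases d) auto

text \<open>The tail is absorbed by Pascal's rule. Equality occurs for d + 1 copies of a; with at
  most d entries the bound is strict, as in \<open>mval_less\<close>.\<close>

lemma mval_le:
  assumes "desc (a # as)" "length (a # as) \<le> Suc d"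
  shows "mval d (a # as) \<le> (Suc a + d choose d)"
  using assms
proof (induction as arbitrary: a d)
  case (Cons b as)
  then have d: "d > 0" by simp
  have "mval (d - 1) (b # as) \<le> (Suc b + (d - 1) choose (d - 1))"
    using Cons.prems by (intro Cons.IH) auto
  also have "\<dots> \<le> (Suc a + (d - 1) choose (d - 1))"
    using Cons.prems by (intro binomial_right_mono) auto
  finally show ?case
    using choose_Suc_step[OF d, of a] by simp
qed (auto intro: binomial_right_mono)

lemma mval_less:
  assumes "desc (a # as)" "length (a # as) \<le> d"
  shows "mval d (a # as) < (Suc a + d choose d)"
  using assms
proof (induction as arbitrary: a d)
  case Nil
  then show ?case using choose_Suc_step[of d a] zero_less_binomial[of "d-1" "Suc a + (d-1)"] by simp
next
  case (Cons b as)
  then have d: "d > 0" by simp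
  have "mval (d - 1) (b # as) < (Suc b + (d - 1) choose (d - 1))"
    using Cons.prems by (intro Cons.IH) auto
  also have "\<dots> \<le> (Suc a + (d - 1) choose (d - 1))"
    using Cons.prems by (intro binomial_right_mono) auto
  finally show ?case
    using choose_Suc_step[OF d, of a] by simp
qed

lemma mlow_less:
  assumes "desc (a # as)" "length (a # as) \<le> d"
  shows "mlow d (a # as) < (a + d choose d)"
  using assms
proof (induction as arbitrary: a d)
  case Nil
  then show ?case
    by (cases d; cases a) (auto simp: )
next
  case (Cons b as)
  then have d: "d > 0" by simp
  have "mlow (d - 1) (b # as) < (b + (d - 1) choose (d - 1))"
    using Cons.prems by (intro Cons.IH) auto
  also have "\<dots> \<le> (a + (d - 1) choose (d - 1))"
    using Cons.prems by (intro binomial_right_mono) auto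
  finally show ?case
    using d by (cases d) auto
qed

text \<open>At the first difference the larger entry alone exceeds the smaller one with all that can
  follow it. The contrapositive turns inequalities of values into \<open>lex_le\<close>;
  \<open>bs\<close> may have d + 1 entries because it will be an expansion in degree d + 1 read in
  degree d.\<close>

lemma mval_strict_mono:
  assumes "\<not> lex_le bs as" "desc as" "length as \<le> d" "length bs \<le> Suc d"
  shows "mval d as < mval d bs"
  using assms
proof (induction bs as arbitrary: d rule: lex_le.induct)
  case (2 b bs)
  then show ?case by simp
next
  case (3 b bs a as)
  show ?case
  proof (cases "a < b")
    case True
    have "mval d (a # as) < (Suc a + d choose d)"
      using "3.prems" by (intro mval_less) auto
    also have "\<dots> \<le> (b + d choose d)"
      using True by (intro binomial_right_mono) auto
    finally show ?thesis by simp
  next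
    case False
    then show ?thesis using 3 by auto
  qed
qed auto

lemma mval_mono:
  assumes "lex_le bs as" "desc bs" "length as \<le> d" "length bs \<le> Suc d"
  shows "mval d bs \<le> mval d as"
  using assms
proof (induction bs as arbitrary: d rule: lex_le.induct)
  case (3 b bs a as)
  show ?case
  proof (cases "b < a")
    case True
    have "mval d (b # bs) \<le> (Suc b + d choose d)"
      using "3.prems" by (intro mval_le) auto
    also have "\<dots> \<le> (a + d choose d)"
      using True by (intro binomial_right_mono) auto
    finally show ?thesis by simp
  next
    case False
    then show ?thesis using 3 by auto
  qed
qed auto

lemma mlow_mono:
  assumes "lex_le bs as" "desc bs" "length bs \<le> d"
  shows "mlow d bs \<le> mlow d as"
  using assms
proof (induction bs as arbitrary: d rule: lex_le.induct)
  case (3 b bs a as)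
  show ?case
  proof (cases "b < a")
    case True
    have "mlow d (b # bs) < (b + d choose d)"
      using "3.prems" by (intro mlow_less) auto
    also have "\<dots> \<le> (a + d - 1 choose d)"
      using True by (intro binomial_right_mono) auto
    finally show ?thesis by simp
  next
    case False
    then show ?thesis using 3 by auto
  qed
qed auto

text \<open>Zero entries of \<open>bs\<close> are excluded because in positive degree a trailing
  zero adds nothing to \<open>mlow\<close>, and the values could agree.\<close>

lemma mlow_strict_mono:
  assumes "\<not> lex_le bs as" "desc as" "length as \<le> d" "0 \<notin> set bs"
  shows "mlow d as < mlow d bs"
  using assms
proof (induction bs as arbitrary: d rule: lex_le.induct)
  case (2 b bs)
  then have "b > 0" by auto
  then have "d \<le> b + d - 1" by linarith
  then show ?case by (simp add: zero_less_binomial_iff)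
next
  case (3 b bs a as)
  show ?case
  proof (cases "a < b")
    case True
    have "mlow d (a # as) < (a + d choose d)"
      using "3.prems" by (intro mlow_less) auto
    also have "\<dots> \<le> (b + d - 1 choose d)"
      using True by (intro binomial_right_mono) auto
    finally show ?thesis by simp
  next
    case False
    then show ?thesis using 3 by auto
  qed
qed (auto simp: zero_less_binomial_iff)

text \<open>Pascal's rule entry by entry; it identifies c - c_<d> with the unchanged list in degree
  d - 1.\<close>

lemma mval_pascal:
  assumes "length as \<le> d"
  shows "mval d as = mlow d as + mval (d - 1) as"
  using assms
proof (induction as arbitrary: d)
  case (Cons a as)
  then obtain e where "d = Suc e" by (cases d) auto
  with Cons show ?case by (simp add: add.assoc)
qed auto

lemma mlow_map_Suc [simp]: "mlow d (map Suc as) = mval d as"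
  by (induction as arbitrary: d) auto

lemma mval_map_pred:
  assumes "0 \<notin> set as"
  shows "mval d (map (\<lambda>a. a - 1) as) = mlow d as"
  using assms by (induction as arbitrary: d) (auto simp: )

lemma mval_append:
  "length as \<le> d \<Longrightarrow> mval d (as @ [b]) = mval d as + (b + (d - length as) choose (d - length as))"
  by (induction as arbitrary: d) auto

lemma mlow_append:
  "length as \<le> d \<Longrightarrow> mlow d (as @ [b]) = mlow d as + (b + (d - length as) - 1 choose (d - length as))"
  by (induction as arbitrary: d) auto

text \<open>
  Adding 1 to an expansion of maximal length is a carry: the trailing block of equal entries $a$
  collapses to a single entry $a + 1$. In particular no entry of the result is 0.
\<close>

lemma succ_expansion:
  assumes "desc as" "length as = d" "as \<noteq> []"
  shows "\<exists>bs. bs \<noteq> [] \<and> desc bs \<and> length bs \<le> d \<and> 0 \<notin> set bs \<and> mval d bs = Suc (mval d as) \<and>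
    mlow d bs = Suc (mlow d as) \<and> (hd bs \<le> hd as \<or> bs = [Suc (hd as)])"
  using assms
proof (induction as arbitrary: d)
  case (Cons a as)
  show ?case
  proof (cases "as = []")
    case True
    then show ?thesis using Cons.prems by (intro exI[of _ "[Suc a]"]) auto
  next
    case False
    have d: "d > 0" using Cons.prems by simp
    have "desc as" "length as = d - 1" using Cons.prems by auto
    from Cons.IH[OF this False] obtain bs where bs: "bs \<noteq> []" "desc bs" "length bs \<le> d - 1" "0 \<notin> set bs"
      "mval (d - 1) bs = Suc (mval (d - 1) as)" "mlow (d - 1) bs = Suc (mlow (d - 1) as)"
      "hd bs \<le> hd as \<or> bs = [Suc (hd as)]"
      by blast
    have "hd as \<le> a" using Cons.prems False by (cases as) auto
    show ?thesis
    \<comment> \<open>Either the carry stops inside the tail, or the tail has collapsed to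
      \<open>[Suc a]\<close> and Pascal's rule merges it with the entry a.\<close>
    proof (cases "hd bs \<le> a")
      case True
      have "x \<le> a" if "x \<in> set bs" for x
        using that bs True by (cases bs) auto
      moreover have "a > 0" using bs True by (cases bs) auto
      ultimately show ?thesis
        using bs True d by (intro exI[of _ "a # bs"]) auto
    next
      case False
      with bs(7) \<open>hd as \<le> a\<close> have "bs = [Suc (hd as)]" by linarith
      with False \<open>hd as \<le> a\<close> have "bs = [Suc a]" by auto
      then show ?thesis using bs d
        by (intro exI[of _ "[Suc a]"]) (cases d; auto)
    qed
  qed
qed auto

text \<open>Counting up instead of the greedy choice: while there is room, a new entry 0 adds 1; at
  full length the carry does.\<close>

lemma ex_expansion:
  assumes "d > 0"
  shows "\<exists>as. desc as \<and> length as \<le> d \<and> mval d as = c"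
proof (induction c)
  case 0
  then show ?case by (intro exI[of _ "[]"]) auto
next
  case (Suc c)
  then obtain as where as: "desc as" "length as \<le> d" "mval d as = c" by blast
  show ?case
  proof (cases "length as = d")
    case True
    then show ?thesis using as assms succ_expansion[of as d] by auto
  next
    case False
    then show ?thesis using as
      by (intro exI[of _ "as @ [0]"]) (auto simp: mval_append sorted_wrt_append)
  qed
qed

lemma expansion_unique:
  assumes "desc as" "length as \<le> d" "desc bs" "length bs \<le> d" "mval d as = mval d bs"
  shows "as = bs"
  using mval_strict_mono[of as bs d] mval_strict_mono[of bs as d] assms lex_le_antisym
  by fastforce

text \<open>In contrast to \<open>binomial_expansion\<close>, c = 0 is included, with the empty
  list: hyperplane sections may have Hilbert function 0.\<close>

definition expansion :: "nat \<Rightarrow> nat \<Rightarrow> nat list" where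
  "expansion d c = (THE as. desc as \<and> length as \<le> d \<and> mval d as = c)"

lemma expansion_props:
  assumes "d > 0"
  shows "desc (expansion d c)" "length (expansion d c) \<le> d" "mval d (expansion d c) = c"
proof -
  have "\<exists>!as. desc as \<and> length as \<le> d \<and> mval d as = c"
    using ex_expansion[OF assms] expansion_unique by metis
  from theI'[OF this] show "desc (expansion d c)" "length (expansion d c) \<le> d" "mval d (expansion d c) = c"
    unfolding expansion_def by auto
qed

lemma expansion_eq:
  assumes "desc as" "length as \<le> d" "mval d as = c" "d > 0"
  shows "expansion d c = as"
  using assms expansion_props[of d c] expansion_unique by metis

definition low :: "nat \<Rightarrow> nat \<Rightarrow> nat" where
  "low d c = mlow d (expansion d c)"

lemma lex_le_expansion:
  assumes "d > 0" "c \<le> c'"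
  shows "lex_le (expansion d c) (expansion d c')"
  using mval_strict_mono[of "expansion d c" "expansion d c'" d] expansion_props[OF assms(1)] assms(2)
  by (metis le_SucI not_less)

lemma low_mono:
  assumes "d > 0" "c \<le> c'"
  shows "low d c \<le> low d c'"
  unfolding low_def using lex_le_expansion[OF assms] expansion_props[OF assms(1)]
  by (intro mlow_mono) auto

lemma low_pascal: "d > 0 \<Longrightarrow> c = low d c + mval (d - 1) (expansion d c)"
  using mval_pascal[of "expansion d c" d] expansion_props[of d c] by (simp add: low_def)

text \<open>
  A list of length $d + 1$ is not an expansion in degree $d$; its last entry contributes
  $\binom{a}{0} = 1$ to both \<open>mval\<close> and \<open>mlow\<close>.
\<close>

lemma low_mval:
  assumes "d > 0" "desc as" "length as \<le> Suc d"
  shows "low d (mval d as) = mlow d as"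
    and "length as = Suc d \<or> 0 \<notin> set as \<Longrightarrow> 0 \<notin> set (expansion d (mval d as))"
proof -
  have "low d (mval d as) = mlow d as \<and>
    (length as = Suc d \<or> 0 \<notin> set as \<longrightarrow> 0 \<notin> set (expansion d (mval d as)))"
  proof (cases "length as \<le> d")
    case True
    then show ?thesis using assms expansion_eq[of as d] by (auto simp: low_def)
  next
    case False
    then obtain bs b where bs: "as = bs @ [b]" "length bs = d"
      using assms by (cases as rule: rev_cases) auto
    with assms obtain cs where cs: "desc cs" "length cs \<le> d" "0 \<notin> set cs" "mval d cs = Suc (mval d bs)"
      "mlow d cs = Suc (mlow d bs)"
      using succ_expansion[of bs d] by (auto simp: sorted_wrt_append)
    moreover have "mval d as = mval d cs" "mlow d as = mlow d cs"
      using bs cs by (simp_all add: mval_append mlow_append)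
    ultimately show ?thesis using expansion_eq[of cs d] assms by (simp add: low_def)
  qed
  then show "low d (mval d as) = mlow d as"
    and "length as = Suc d \<or> 0 \<notin> set as \<Longrightarrow> 0 \<notin> set (expansion d (mval d as))" by auto
qed

text \<open>The numerical half of Green's theorem; c and m are the codimensions before and after
  restriction. If \<open>bs\<close> expands m, then \<open>map Suc bs\<close> has lower value m, and
  the hypothesis forces its value to be at most c, so that \<open>low_mono\<close> applies.\<close>

lemma le_low_of_restriction:
  assumes "d \<ge> 2" "m < c" and le: "m \<le> low d m + low (d - 1) (c - m)"
  shows "m \<le> low d c"
proof -
  define bs where "bs = expansion d m"
  have bs: "desc bs" "length bs \<le> d" "mval d bs = m"
    using expansion_props[of d m] assms by (auto simp: bs_def)
  define as where "as = expansion (d - 1) (c - m)"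
  have as: "desc as" "length as \<le> d - 1" "mval (d - 1) as = c - m"
    using expansion_props[of "d - 1" "c - m"] assms by (auto simp: as_def)
  have bs': "desc (map Suc bs)" "length (map Suc bs) \<le> d"
    using bs by (auto simp: sorted_wrt_map)
  have "mval (d - 1) bs \<le> mlow (d - 1) as"
    using le low_pascal[of d m] assms unfolding bs_def as_def low_def[of "d - 1"] by linarith
  then have "lex_le (map Suc bs) as"
    using mlow_strict_mono[of "map Suc bs" as "d - 1"] as by fastforce
  then have "mval (d - 1) (map Suc bs) \<le> c - m"
    using mval_mono[of "map Suc bs" as "d - 1"] as bs' assms by auto
  moreover have "mval d (map Suc bs) = m + mval (d - 1) (map Suc bs)"
    using mval_pascal[of "map Suc bs" d] bs bs' by simp
  ultimately have "mval d (map Suc bs) \<le> c" using assms by linarith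
  then have "low d (mval d (map Suc bs)) \<le> low d c"
    using assms by (intro low_mono) auto
  then show ?thesis using low_mval(1)[of d "map Suc bs"] bs bs' assms by simp
qed

text \<open>Zero entries stand at the end and contribute 0, because with at most d entries all
  degrees are positive.\<close>

lemma mlow_eq_mval:
  assumes "desc as" "length as \<le> d"
  shows "mlow d as = mval d (map (\<lambda>a. a - 1) (filter (\<lambda>a. 0 < a) as))"
  using assms
proof (induction as arbitrary: d)
  case (Cons a as)
  show ?case
  proof (cases a)
    case 0
    then have "filter (\<lambda>a. 0 < a) (a # as) = []" using Cons.prems by (auto simp: filter_empty_conv)
    moreover have "mlow d (a # as) < 1" using mlow_less[OF Cons.prems] 0 by simp
    ultimately show ?thesis by (metis less_one list.map(1) mval.simps(1))
  next
    case (Suc b)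
    then show ?thesis using Cons by auto
  qed
qed auto

section \<open>Agreement with the binomial expansions of the statement\<close>

lemma mval_conv_sum: "mval d as = (\<Sum>j<length as. (as ! j + (d - j)) choose (d - j))"
proof (induction as arbitrary: d)
  case (Cons a as)
  have "(\<Sum>j<length (a # as). ((a # as) ! j + (d - j)) choose (d - j)) =
     (a + d choose d) + (\<Sum>j<length as. (as ! j + (d - 1 - j)) choose (d - 1 - j))"
    by (simp add: sum.lessThan_Suc_shift del: sum.lessThan_Suc)
  with Cons show ?case by simp
qed simp

lemma mlow_conv_sum: "mlow d as = (\<Sum>j<length as. (as ! j + (d - j) - 1) choose (d - j))"
proof (induction as arbitrary: d)
  case (Cons a as)
  have "(\<Sum>j<length (a # as). ((a # as) ! j + (d - j) - 1) choose (d - j)) =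
     (a + d - 1 choose d) + (\<Sum>j<length as. (as ! j + (d - 1 - j) - 1) choose (d - 1 - j))"
    by (simp add: sum.lessThan_Suc_shift del: sum.lessThan_Suc)
  with Cons show ?case by simp
qed simp

text \<open>Subtracting the staircase d - j matches strictly decreasing \<open>ks\<close> with
  weakly decreasing \<open>as\<close>; the condition on \<open>last ks\<close> makes the last
  difference, hence every one, nonnegative.\<close>

lemma is_binomial_expansion_iff:
  "is_binomial_expansion d c ks \<longleftrightarrow>
    (\<exists>as. as \<noteq> [] \<and> desc as \<and> length as \<le> d \<and> mval d as = c \<and>
      ks = map (\<lambda>j. as ! j + (d - j)) [0..<length as])"
proof
  assume "is_binomial_expansion d c ks"
  then have ks: "ks \<noteq> []" "length ks \<le> d" "sorted_wrt (>) ks" "last ks \<ge> d - (length ks - 1)"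
    "c = (\<Sum>j<length ks. (ks ! j) choose (d - j))"
    by (auto simp: is_binomial_expansion_def)
  define as where "as = map (\<lambda>j. ks ! j - (d - j)) [0..<length ks]"
  have gap: "ks ! (i + k) + k \<le> ks ! i" if "i + k < length ks" for i k
    using that
  proof (induction k)
    case (Suc k)
    then have "ks ! (i + Suc k) < ks ! (i + k)"
      using ks(3) by (auto simp: sorted_wrt_iff_nth_less)
    with Suc show ?case by auto
  qed simp
  have ge: "d - j \<le> ks ! j" if "j < length ks" for j
    using gap[of j "length ks - 1 - j"] ks that by (auto simp: last_conv_nth)
  have "desc as"
    unfolding sorted_wrt_iff_nth_less
  proof (intro allI impI)
    fix i j assume ij: "i < j" "j < length as"
    then have "ks ! j + (j - i) \<le> ks ! i" using gap[of i "j - i"] by (auto simp: as_def)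
    then show "as ! j \<le> as ! i" using ij ks by (auto simp: as_def)
  qed
  moreover have "ks = map (\<lambda>j. as ! j + (d - j)) [0..<length as]"
    by (rule nth_equalityI) (auto simp: as_def ge)
  moreover have "mval d as = c"
    unfolding mval_conv_sum ks(5) by (intro sum.cong) (auto simp: as_def ge)
  moreover have "as \<noteq> []" "length as \<le> d" using ks by (simp_all add: as_def)
  ultimately show "\<exists>as. as \<noteq> [] \<and> desc as \<and> length as \<le> d \<and> mval d as = c \<and>
      ks = map (\<lambda>j. as ! j + (d - j)) [0..<length as]"
    by blast
next
  assume "\<exists>as. as \<noteq> [] \<and> desc as \<and> length as \<le> d \<and> mval d as = c \<and>
      ks = map (\<lambda>j. as ! j + (d - j)) [0..<length as]"
  then obtain as where as: "as \<noteq> []" "desc as" "length as \<le> d" "mval d as = c"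
    and ks: "ks = map (\<lambda>j. as ! j + (d - j)) [0..<length as]" by blast
  have "sorted_wrt (>) ks"
    unfolding sorted_wrt_iff_nth_less
  proof (intro allI impI)
    fix i j assume ij: "i < j" "j < length ks"
    then have "as ! j \<le> as ! i" using as(2) by (auto simp: sorted_wrt_iff_nth_less ks)
    moreover have "d - j < d - i" using ij as(3) by (auto simp: ks)
    ultimately show "ks ! j < ks ! i" using ij by (auto simp: ks)
  qed
  then show "is_binomial_expansion d c ks"
    using as by (auto simp: is_binomial_expansion_def ks last_conv_nth mval_conv_sum)
qed

lemma binomial_expansion_eq:
  assumes "d > 0" "c > 0"
  shows "binomial_expansion d c =
    map (\<lambda>j. expansion d c ! j + (d - j)) [0..<length (expansion d c)]"
  unfolding binomial_expansion_def
proof (rule the_equality)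
  have "expansion d c \<noteq> []" using expansion_props(3)[of d c] assms by auto
  then show "is_binomial_expansion d c (map (\<lambda>j. expansion d c ! j + (d - j)) [0..<length (expansion d c)])"
    unfolding is_binomial_expansion_iff using expansion_props[of d c] assms by blast
  show "ks = map (\<lambda>j. expansion d c ! j + (d - j)) [0..<length (expansion d c)]"
    if "is_binomial_expansion d c ks" for ks
  proof -
    from that obtain as where "desc as" "length as \<le> d" "mval d as = c"
      and ks: "ks = map (\<lambda>j. as ! j + (d - j)) [0..<length as]"
      unfolding is_binomial_expansion_iff by blast
    then have "expansion d c = as" using assms by (intro expansion_eq) auto
    with ks show ?thesis by simp
  qed
qed

lemma macaulay_set_eq:
  assumes "d > 0" "c > 0"
  shows "macaulay_set d c = expansion d c"
  unfolding macaulay_set_def binomial_expansion_eq[OF assms] Let_def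
  by (rule nth_equalityI) auto

lemma macaulay_lower_eq:
  assumes "d > 0" "c > 0"
  shows "macaulay_lower d c = low d c"
  unfolding macaulay_lower_def binomial_expansion_eq[OF assms] Let_def low_def mlow_conv_sum
  by (intro sum.cong) auto

text \<open>The lexicographic order alone is not well-founded: [1], [0, 1], [0, 0, 1], ... decreases
  forever. In a descending \<open>bs\<close>, however, every entry from the first difference on is
  smaller than the entry of \<open>as\<close> at that place, so the well-founded multiset order
  decreases too.\<close>

lemma lex_less_imp_mult:
  assumes "lex_le bs as" "as \<noteq> bs" "desc bs"
  shows "(mset bs, mset as) \<in> mult {(x, y). x < y}"
  using assms
proof (induction bs as rule: lex_le.induct)
  case (1 as)
  then show ?case
    using one_step_implies_mult[of "mset as" "{#}" "{(x, y). x < y}" "{#}"] by auto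
next
  case (3 b bs a as)
  show ?case
  proof (cases "b < a")
    case True
    then have "\<forall>k\<in>#mset (b # bs). \<exists>j\<in>#mset (a # as). (k, j) \<in> {(x, y). x < y}"
      using 3 by (auto intro!: bexI[of _ a])
    then show ?thesis
      using one_step_implies_mult[of "mset (a # as)" "mset (b # bs)" "{(x, y). x < y}" "{#}"] by auto
  next
    case False
    then have "(mset bs, mset as) \<in> mult {(x, y). x < y}" "a = b" using 3 by auto
    then show ?thesis by (simp add: mult_cancel_add_mset trans_def irrefl_on_def)
  qed
qed auto

lemma lex_decreasing_stabilizes:
  assumes "\<And>t. t \<ge> t0 \<Longrightarrow> desc (L t)" "\<And>t. t \<ge> t0 \<Longrightarrow> lex_le (L (Suc t)) (L t)"
  shows "\<exists>t1\<ge>t0. \<forall>t\<ge>t1. L t = L t1"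
proof -
  define r where "r = mult {(x, y). x < (y :: nat)}"
  have "wf r" unfolding r_def by (intro wf_mult wf)
  moreover have "mset (L t0) \<in> (\<lambda>t. mset (L t)) ` {t0..}" by auto
  ultimately obtain z where z: "z \<in> (\<lambda>t. mset (L t)) ` {t0..}"
    "\<And>y. (y, z) \<in> r \<Longrightarrow> y \<notin> (\<lambda>t. mset (L t)) ` {t0..}"
    by (rule wfE_min) blast
  then obtain t1 where t1: "t1 \<ge> t0" "z = mset (L t1)" by auto
  have "L t = L t1" if "t \<ge> t1" for t
    using that
  proof (induction t rule: dec_induct)
    case (step t)
    have "lex_le (L (Suc t)) (L t1)" using assms(2)[of t] step t1 by simp
    then have "L t1 \<noteq> L (Suc t) \<longrightarrow> (mset (L (Suc t)), z) \<in> r"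
      unfolding r_def t1 using lex_less_imp_mult assms(1) step t1 by simp
    moreover have "(mset (L (Suc t)), z) \<notin> r" using z(2)[of "mset (L (Suc t))"] step t1 by auto
    ultimately show ?case by metis
  qed simp
  with t1 show ?thesis by blast
qed

section \<open>Dimensions of finite-dimensional subspaces\<close>

context vector_space begin

text \<open>A condition on subsets, since the polynomial ring is infinite-dimensional and only its
  graded pieces matter.\<close>

definition finite_dim :: "'b set \<Rightarrow> bool" where
  "finite_dim V \<longleftrightarrow> (\<exists>C. finite C \<and> V \<subseteq> span C)"


end

hide_const (open) real_vector.finite_dim

context vector_space begin

lemma finite_dim_subset: "finite_dim V \<Longrightarrow> U \<subseteq> V \<Longrightarrow> finite_dim U"
  unfolding finite_dim_def by blast

lemma independent_card_le_dim_finite: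
  assumes "independent B" "B \<subseteq> V" "finite_dim V"
  shows "finite B" "card B \<le> dim V"
proof -
  obtain C where C: "finite C" "V \<subseteq> span C" using assms unfolding finite_dim_def by blast
  obtain D where D: "D \<subseteq> V" "independent D" "V \<subseteq> span D" "card D = dim V"
    by (rule basis_exists)
  have "finite D" using independent_span_bound[OF C(1) D(2)] D C by auto
  then show "finite B" "card B \<le> dim V"
    using independent_span_bound[of D B] assms D by auto
qed

lemma finite_dim_basis:
  assumes "finite_dim V"
  obtains B where "B \<subseteq> V" "independent B" "V \<subseteq> span B" "card B = dim V" "finite B"
proof -
  obtain B where B: "B \<subseteq> V" "independent B" "V \<subseteq> span B" "card B = dim V"
    by (rule basis_exists)
  moreover have "finite B" using independent_card_le_dim_finite(1)[OF B(2,1) assms] .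
  ultimately show ?thesis using that by blast
qed

lemma dim_subset_finite:
  assumes "U \<subseteq> V" "finite_dim V"
  shows "dim U \<le> dim V"
proof -
  obtain B where "B \<subseteq> U" "independent B" "card B = dim U"
    by (rule basis_exists)
  with independent_card_le_dim_finite(2)[of B V] assms show ?thesis by auto
qed

lemma subspace_eq_of_dim_ge:
  assumes "U \<subseteq> V" "finite_dim V" "subspace U" "dim V \<le> dim U"
  shows "U = V"
proof (rule ccontr)
  assume "U \<noteq> V"
  then obtain v where v: "v \<in> V" "v \<notin> U" using assms by auto
  obtain B where B: "B \<subseteq> U" "independent B" "U \<subseteq> span B" "card B = dim U" "finite B"
    using finite_dim_basis[of U] finite_dim_subset assms by metis
  have "v \<notin> span B" using v B assms span_minimal by blast
  then have "independent (insert v B)" "v \<notin> B" using B independent_insertI span_base by auto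
  moreover have "insert v B \<subseteq> V" using v B assms by auto
  ultimately have "card (insert v B) \<le> dim V"
    using assms independent_card_le_dim_finite by blast
  then show False using assms B \<open>v \<notin> B\<close> by simp
qed

text \<open>Rank-nullity for the map from U to the quotient by W induced by f, phrased without
  quotients: a basis of the kernel is extended to U, and the images of the new vectors complete a
  basis of W to one of W + f(U).\<close>

lemma dim_sum_image_plus_dim_preimage:
  assumes U: "subspace U" "finite_dim U" and W: "subspace W" "finite_dim W"
    and f: "module_hom scale scale f"
  shows "dim {w + f u | w u. w \<in> W \<and> u \<in> U} + dim {u \<in> U. f u \<in> W} = dim W + dim U"
proof -
  interpret f: module_hom scale scale f by (rule f)
  define K where "K = {u \<in> U. f u \<in> W}"
  have K: "subspace K" "K \<subseteq> U"
    using U W unfolding K_def subspace_def by (auto simp: f.add f.scale f.zero)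
  obtain BK where BK: "BK \<subseteq> K" "independent BK" "K \<subseteq> span BK" "card BK = dim K" "finite BK"
    using finite_dim_basis[of K] finite_dim_subset U K by metis
  obtain BU where BU: "BK \<subseteq> BU" "BU \<subseteq> U" "independent BU" "U \<subseteq> span BU"
    using maximal_independent_subset_extend[of BK U] BK K by blast
  have fin: "finite BU" using independent_card_le_dim_finite BU U by blast
  have cardU: "card BU = dim U" using basis_card_eq_dim BU by blast
  obtain BW where BW: "BW \<subseteq> W" "independent BW" "W \<subseteq> span BW" "card BW = dim W" "finite BW"
    using finite_dim_basis[of W] W by metis
  have spW: "span BW = W" using BW W by (metis span_subspace)
  have "independent (BW \<union> f ` X) \<and> card (BW \<union> f ` X) = card BW + card X"
    if "X \<subseteq> BU - BK" for X
    using finite_subset[OF that finite_Diff[OF fin]] that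
  proof (induction X rule: finite_induct)
    case (insert u X)
    \<comment> \<open>A relation f u = w + f x puts u - x into the kernel K, and so expresses u by
      other members of \<open>BU\<close>.\<close>
    have "f u \<notin> span (BW \<union> f ` X)"
    proof
      assume "f u \<in> span (BW \<union> f ` X)"
      then obtain w x where wx: "w \<in> W" "x \<in> span X" "f u = w + f x"
        unfolding span_Un f.span_image spW by auto
      have "x \<in> U" using wx(2) insert.prems BU span_minimal[of X U] U by blast
      then have "u - x \<in> K"
        using wx insert.prems BU U by (auto simp: K_def f.diff subspace_diff)
      then have "u - x \<in> span (BU - {u})"
        using BK span_mono[of BK "BU - {u}"] insert.prems BU by blast
      moreover have "x \<in> span (BU - {u})"
        using wx(2) span_mono[of X "BU - {u}"] insert by blast
      ultimately have "u \<in> span (BU - {u})" using span_add by force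
      then show False using BU insert.prems by (auto simp: dependent_def)
    qed
    then have "independent (insert (f u) (BW \<union> f ` X))" "f u \<notin> BW \<union> f ` X"
      using insert independent_insertI span_base[of "f u" "BW \<union> f ` X"] by blast+
    then show ?case using insert BW by simp
  qed (use BW in auto)
  from this[of "BU - BK"]
  have ind: "independent (BW \<union> f ` (BU - BK))"
    and "card (BW \<union> f ` (BU - BK)) + card BK = card BW + card BU"
    using BU fin card_mono[OF fin BU(1)] by (auto simp: card_Diff_subset finite_subset)
  moreover have "dim {w + f u | w u. w \<in> W \<and> u \<in> U} = card (BW \<union> f ` (BU - BK))"
  proof (rule dim_unique[OF _ _ ind refl])
    have "w = w + f 0" "f u = 0 + f u" for w u by (simp_all add: f.zero)
    then show "BW \<union> f ` (BU - BK) \<subseteq> {w + f u | w u. w \<in> W \<and> u \<in> U}"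
      using BW BU U W subspace_0[of U] subspace_0[of W] by blast
    have "f u \<in> span (BW \<union> f ` (BU - BK))" if "u \<in> U" for u
    proof -
      have "u \<in> span (BK \<union> (BU - BK))" using that BU by (auto simp: Un_absorb1)
      then obtain k x where kx: "k \<in> span BK" "x \<in> span (BU - BK)" "u = k + x"
        unfolding span_Un by auto
      have "k \<in> K" using kx(1) BK K span_minimal by blast
      then have "f k \<in> span BW" using spW by (auto simp: K_def)
      moreover have "f x \<in> span (f ` (BU - BK))" using kx unfolding f.span_image by blast
      ultimately show ?thesis unfolding kx(3) f.add span_Un by blast
    qed
    moreover have "w \<in> span (BW \<union> f ` (BU - BK))" if "w \<in> W" for w
      using that spW span_mono[of BW "BW \<union> f ` (BU - BK)"] by blast
    ultimately show "{w + f u | w u. w \<in> W \<and> u \<in> U} \<subseteq> span (BW \<union> f ` (BU - BK))"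
      by (auto intro: span_add)
  qed
  ultimately show ?thesis using BK BW cardU unfolding K_def by simp
qed

end

section \<open>General linear forms\<close>

definition eval_monom :: "(nat \<Rightarrow> 'k::comm_ring_1) \<Rightarrow> (nat \<Rightarrow>\<^sub>0 nat) \<Rightarrow> 'k" where
  "eval_monom a m = (\<Prod>i\<in>Poly_Mapping.keys m. a i ^ Poly_Mapping.lookup m i)"

lemma eval_monom_superset:
  assumes "finite A" "Poly_Mapping.keys m \<subseteq> A"
  shows "eval_monom a m = (\<Prod>i\<in>A. a i ^ Poly_Mapping.lookup m i)"
  unfolding eval_monom_def using assms by (intro prod.mono_neutral_left) (auto simp: in_keys_iff)

lemma eval_monom_add: "eval_monom a (m + m') = eval_monom a m * eval_monom a m'"
proof -
  define A where "A = Poly_Mapping.keys m \<union> Poly_Mapping.keys m'"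
  have "finite A" "Poly_Mapping.keys m \<subseteq> A" "Poly_Mapping.keys m' \<subseteq> A" "Poly_Mapping.keys (m + m') \<subseteq> A"
    using Poly_Mapping.keys_add[of m m'] by (auto simp: A_def)
  then show ?thesis
    by (simp add: eval_monom_superset[of A] lookup_add power_add prod.distrib)
qed

lemma eval_mpoly_superset:
  assumes "finite A" "Poly_Mapping.keys p \<subseteq> A"
  shows "eval_mpoly p a = (\<Sum>m\<in>A. Poly_Mapping.lookup p m * eval_monom a m)"
  unfolding eval_mpoly_def eval_monom_def[symmetric] using assms
  by (intro sum.mono_neutral_left) (auto simp: in_keys_iff)

lemma eval_mpoly_add: "eval_mpoly (p + q) a = eval_mpoly p a + eval_mpoly q a"
proof -
  define A where "A = Poly_Mapping.keys p \<union> Poly_Mapping.keys q"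
  have "finite A" "Poly_Mapping.keys p \<subseteq> A" "Poly_Mapping.keys q \<subseteq> A" "Poly_Mapping.keys (p + q) \<subseteq> A"
    using Poly_Mapping.keys_add[of p q] by (auto simp: A_def)
  then show ?thesis
    by (simp add: eval_mpoly_superset[of A] lookup_add sum.distrib ring_distribs)
qed

lemma eval_mpoly_single: "eval_mpoly (Poly_Mapping.single m c) a = c * eval_monom a m"
  by (subst eval_mpoly_superset[of "{m}"]) auto

lemma eval_mpoly_0 [simp]: "eval_mpoly 0 a = 0"
  by (simp add: eval_mpoly_def)

lemma eval_mpoly_sum: "eval_mpoly (\<Sum>x\<in>A. f x) a = (\<Sum>x\<in>A. eval_mpoly (f x) a)"
  by (induction A rule: infinite_finite_induct) (auto simp: eval_mpoly_add)

lemma sum_singles: "(\<Sum>m\<in>Poly_Mapping.keys p. Poly_Mapping.single m (Poly_Mapping.lookup p m)) = p"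
  by (rule poly_mapping_eqI) (auto simp: lookup_sum lookup_single when_def sum.delta in_keys_iff)

lemma eval_mpoly_mult: "eval_mpoly (p * q) a = eval_mpoly p a * eval_mpoly q a"
proof -
  have "p * q = (\<Sum>m\<in>Poly_Mapping.keys p. \<Sum>m'\<in>Poly_Mapping.keys q.
      Poly_Mapping.single (m + m') (Poly_Mapping.lookup p m * Poly_Mapping.lookup q m'))"
    unfolding mult_single[symmetric] sum_product[symmetric] sum_singles ..
  then show ?thesis
    by (simp add: eval_mpoly_sum eval_mpoly_single eval_monom_add sum_product algebra_simps)
       (simp add: eval_mpoly_def eval_monom_def[symmetric] sum_product algebra_simps)
qed

lemma polys_0 [simp]: "0 \<in> polys n"
  by (simp add: polys_def)

lemma polys_add: "p \<in> polys n \<Longrightarrow> q \<in> polys n \<Longrightarrow> p + q \<in> polys n"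
  using Poly_Mapping.keys_add[of p q] by (auto simp: polys_def)

lemma keys_add_nat: "Poly_Mapping.keys (m + m') = Poly_Mapping.keys m \<union> Poly_Mapping.keys (m' :: nat \<Rightarrow>\<^sub>0 nat)"
  by (auto simp: in_keys_iff lookup_add)

lemma polys_mult: "p \<in> polys n \<Longrightarrow> q \<in> polys n \<Longrightarrow> p * q \<in> polys n"
  using Poly_Mapping.keys_mult[of p q] by (fastforce simp: polys_def keys_add_nat)

lemma polys_single: "Poly_Mapping.keys m \<subseteq> {..n} \<Longrightarrow> Poly_Mapping.single m c \<in> polys n"
  by (auto simp: polys_def)

lemma base_digits_unique:
  fixes f g :: "nat \<Rightarrow> nat"
  assumes "\<And>i. i < N \<Longrightarrow> f i < D" "\<And>i. i < N \<Longrightarrow> g i < D"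
    and "(\<Sum>i<N. f i * D ^ i) = (\<Sum>i<N. g i * D ^ i)"
  shows "\<forall>i<N. f i = g i"
  using assms
proof (induction N arbitrary: f g)
  case (Suc N)
  have split: "(\<Sum>i<Suc N. h i * D ^ i) = h 0 + D * (\<Sum>i<N. h (Suc i) * D ^ i)" for h :: "nat \<Rightarrow> nat"
    by (simp add: sum.lessThan_Suc_shift sum_distrib_left algebra_simps del: sum.lessThan_Suc)
  have eq: "f 0 + D * (\<Sum>i<N. f (Suc i) * D ^ i) = g 0 + D * (\<Sum>i<N. g (Suc i) * D ^ i)"
    using Suc.prems(3) unfolding split .
  then have "(f 0 + D * (\<Sum>i<N. f (Suc i) * D ^ i)) mod D = (g 0 + D * (\<Sum>i<N. g (Suc i) * D ^ i)) mod D"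
    by simp
  then have 0: "f 0 = g 0" using Suc.prems(1,2)[of 0] by simp
  moreover have "D > 0" using Suc.prems(1)[of 0] by simp
  ultimately have "(\<Sum>i<N. f (Suc i) * D ^ i) = (\<Sum>i<N. g (Suc i) * D ^ i)"
    using eq by simp
  then have "\<forall>i<N. f (Suc i) = g (Suc i)"
    using Suc.prems by (intro Suc.IH) auto
  with 0 show ?case by (auto simp: less_Suc_eq_0_disj)
qed simp

text \<open>
  Kronecker substitution $x_i = s^{D^i}$, which is injective on exponent vectors with all entries
  below $D$.
\<close>

lemma ex_eval_mpoly_nonzero:
  fixes F :: "'k::field_char_0 mpoly"
  assumes "F \<in> polys n" "F \<noteq> 0"
  shows "\<exists>a. eval_mpoly F a \<noteq> 0"
proof -
  define D where "D = Suc (Max (insert 0 (\<Union>m\<in>Poly_Mapping.keys F. Poly_Mapping.lookup m ` {..n})))"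
  have D: "Poly_Mapping.lookup m i < D" if "m \<in> Poly_Mapping.keys F" "i \<le> n" for m i
  proof -
    have "Poly_Mapping.lookup m i \<le> Max (insert 0 (\<Union>m\<in>Poly_Mapping.keys F. Poly_Mapping.lookup m ` {..n}))"
      using that by (intro Max_ge) auto
    then show ?thesis by (simp add: D_def)
  qed
  have keys: "Poly_Mapping.keys m \<subseteq> {..n}" if "m \<in> Poly_Mapping.keys F" for m
    using that assms(1) by (auto simp: polys_def)
  define e where "e m = (\<Sum>i<Suc n. Poly_Mapping.lookup m i * D ^ i)" for m :: "nat \<Rightarrow>\<^sub>0 nat"
  have inj: "m = m'" if m: "m \<in> Poly_Mapping.keys F" "m' \<in> Poly_Mapping.keys F" and e: "e m = e m'" for m m'
  proof (rule poly_mapping_eqI)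
    fix i
    have "\<forall>i<Suc n. Poly_Mapping.lookup m i = Poly_Mapping.lookup m' i"
      using e D m unfolding e_def by (intro base_digits_unique[of _ _ D]) auto
    then show "Poly_Mapping.lookup m i = Poly_Mapping.lookup m' i"
      using keys[OF m(1)] keys[OF m(2)]
      by (cases "i < Suc n") (simp, metis atMost_iff in_keys_iff less_Suc_eq_le subsetD)
  qed
  define a where "a s i = s ^ (D ^ i)" for s :: 'k and i :: nat
  have ev: "eval_monom (a s) m = s ^ e m" if "m \<in> Poly_Mapping.keys F" for m s
    using eval_monom_superset[of "{..<Suc n}" m "a s"] keys[OF that]
    by (auto simp: e_def a_def power_sum simp flip: power_mult simp: mult.commute lessThan_Suc_atMost)
  define P where "P = (\<Sum>m\<in>Poly_Mapping.keys F. monom (Poly_Mapping.lookup F m) (e m))"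
  have P: "poly P s = eval_mpoly F (a s)" for s
    using eval_mpoly_superset[of "Poly_Mapping.keys F" F "a s"]
    by (simp add: P_def poly_sum poly_monom ev)
  obtain m where m: "m \<in> Poly_Mapping.keys F" using assms(2)
    by (metis sum_singles sum.empty equals0I)
  have "coeff P (e m) = (\<Sum>m'\<in>Poly_Mapping.keys F. if m' = m then Poly_Mapping.lookup F m' else 0)"
    unfolding P_def coeff_sum by (intro sum.cong) (auto dest: inj[OF _ m])
  then have "coeff P (e m) \<noteq> 0" using m by (simp add: in_keys_iff)
  then have "P \<noteq> 0" by auto
  then have "finite {s. poly P s = 0}" by (rule poly_roots_finite)
  then obtain s where "poly P s \<noteq> 0"
    using infinite_UNIV_char_0[where 'a = 'k] by (metis (mono_tags) UNIV_eq_I mem_Collect_eq)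
  then show ?thesis using P by metis
qed

text \<open>The product of the two witnesses is nonzero because the polynomial ring is a
  domain.\<close>

lemma for_general_conj:
  fixes P Q :: "'k::field mpoly \<Rightarrow> bool"
  assumes "for_general_linear_form n P" "for_general_linear_form n Q"
  shows "for_general_linear_form n (\<lambda>h. P h \<and> Q h)"
proof -
  obtain F G where "F \<in> polys n" "F \<noteq> 0" "\<And>a. eval_mpoly F a \<noteq> 0 \<Longrightarrow> P (linear_form n a)"
    "G \<in> polys n" "G \<noteq> 0" "\<And>a. eval_mpoly G a \<noteq> 0 \<Longrightarrow> Q (linear_form n a)"
    using assms unfolding for_general_linear_form_def by blast
  then show ?thesis unfolding for_general_linear_form_def
    by (intro bexI[of _ "F * G"]) (auto simp: eval_mpoly_mult polys_mult)
qed

lemma for_general_mono: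
  assumes "for_general_linear_form n P" "\<And>a. P (linear_form n a) \<Longrightarrow> Q (linear_form n a)"
  shows "for_general_linear_form n Q"
  using assms unfolding for_general_linear_form_def by blast

lemma for_general_ex:
  fixes P :: "'k::field_char_0 mpoly \<Rightarrow> bool"
  assumes "for_general_linear_form n P"
  shows "\<exists>a. P (linear_form n a)"
  using assms ex_eval_mpoly_nonzero unfolding for_general_linear_form_def by blast

section \<open>Openness of linear independence\<close>

definition polynomial_function :: "nat \<Rightarrow> ((nat \<Rightarrow> 'k::comm_ring_1) \<Rightarrow> 'k) \<Rightarrow> bool" where
  "polynomial_function n f \<longleftrightarrow> (\<exists>F\<in>polys n. \<forall>a. f a = eval_mpoly F a)"

lemma polynomial_function_const: "polynomial_function n (\<lambda>a. c)"
  unfolding polynomial_function_def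
  by (intro bexI[of _ "Poly_Mapping.single 0 c"]) (auto simp: eval_mpoly_single eval_monom_def polys_single)

lemma polynomial_function_var: "i \<le> n \<Longrightarrow> polynomial_function n (\<lambda>a. a i)"
  unfolding polynomial_function_def
  by (intro bexI[of _ "Poly_Mapping.single (Poly_Mapping.single i 1) 1"])
     (auto simp: eval_mpoly_single eval_monom_def polys_single)

lemma polynomial_function_add:
  "polynomial_function n f \<Longrightarrow> polynomial_function n g \<Longrightarrow> polynomial_function n (\<lambda>a. f a + g a)"
  unfolding polynomial_function_def by (metis eval_mpoly_add polys_add)

lemma polynomial_function_mult:
  "polynomial_function n f \<Longrightarrow> polynomial_function n g \<Longrightarrow> polynomial_function n (\<lambda>a. f a * g a)"
  unfolding polynomial_function_def by (metis eval_mpoly_mult polys_mult)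

lemma polynomial_function_diff:
  "polynomial_function n f \<Longrightarrow> polynomial_function n g \<Longrightarrow> polynomial_function n (\<lambda>a. f a - g a)"
  using polynomial_function_add[of n f "\<lambda>a. (-1) * g a"]
    polynomial_function_mult[OF polynomial_function_const[of n "-1"], of g] by simp

lemma polynomial_function_sum:
  "(\<And>x. x \<in> A \<Longrightarrow> polynomial_function n (f x)) \<Longrightarrow> polynomial_function n (\<lambda>a. \<Sum>x\<in>A. f x a)"
  by (induction A rule: infinite_finite_induct)
     (auto simp: polynomial_function_const polynomial_function_add)

lemmas polynomial_function_intros = polynomial_function_const polynomial_function_var
  polynomial_function_add polynomial_function_mult polynomial_function_diff polynomial_function_sum

text \<open>Indexed families instead of sets, because vectors that coincide for some parameter value
  must count as dependent.\<close>

definition independent_family :: "'x set \<Rightarrow> ('x \<Rightarrow> 'm \<Rightarrow> 'k::field) \<Rightarrow> bool" where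
  "independent_family X u \<longleftrightarrow> (\<forall>c. (\<forall>m. (\<Sum>x\<in>X. c x * u x m) = 0) \<longrightarrow> (\<forall>x\<in>X. c x = 0))"

text \<open>
  Gaussian elimination with polynomial entries; the witness is the product of the pivots.
\<close>

lemma independent_family_open:
  fixes u :: "(nat \<Rightarrow> 'k::field) \<Rightarrow> 'x \<Rightarrow> 'm \<Rightarrow> 'k"
  assumes "finite X" "\<And>x m. x \<in> X \<Longrightarrow> polynomial_function n (\<lambda>a. u a x m)"
    and "independent_family X (u a0)"
  shows "\<exists>f. polynomial_function n f \<and> f a0 \<noteq> 0 \<and> (\<forall>a. f a \<noteq> 0 \<longrightarrow> independent_family X (u a))"
  using assms
proof (induction X arbitrary: u rule: finite_induct)
  case empty
  then show ?case
    by (intro exI[of _ "\<lambda>a. 1"]) (auto simp: independent_family_def polynomial_function_const)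
next
  case (insert y X)
  have "\<exists>m. u a0 y m \<noteq> 0"
  proof (rule ccontr)
    assume "\<not> ?thesis"
    then have "(\<Sum>x\<in>insert y X. (if x = y then 1 else 0) * u a0 x m) = 0" for m
      by (intro sum.neutral) auto
    with insert.prems(2) have "\<forall>x\<in>insert y X. (if x = y then 1 else 0 :: 'k) = 0"
      unfolding independent_family_def by (elim allE[of _ "\<lambda>x. if x = y then 1 else 0"]) blast
    then show False by auto
  qed
  then obtain p where p: "u a0 y p \<noteq> 0" by blast
  \<comment> \<open>Elimination without division, to stay polynomial in a: the combination cancels
    column p, whose pivot is \<open>u a y p\<close>.\<close>
  define w where "w a x m = u a y p * u a x m - u a x p * u a y m" for a x m
  have w_sum: "(\<Sum>x\<in>X. c x * w a x m) = u a y p * (\<Sum>x\<in>X. c x * u a x m) - (\<Sum>x\<in>X. c x * u a x p) * u a y m"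
    for c a m
    by (simp add: w_def algebra_simps sum_subtractf sum_distrib_left sum_distrib_right)
  have "independent_family X (w a0)"
    unfolding independent_family_def
  proof (intro allI impI)
    fix c assume c: "\<forall>m. (\<Sum>x\<in>X. c x * w a0 x m) = 0"
    define c' where "c' x = (if x = y then - (\<Sum>x\<in>X. c x * u a0 x p) else u a0 y p * c x)" for x
    have "(\<Sum>x\<in>X. c' x * u a0 x m) = u a0 y p * (\<Sum>x\<in>X. c x * u a0 x m)" for m
      unfolding sum_distrib_left using insert.hyps by (intro sum.cong) (auto simp: c'_def)
    then have "\<forall>m. (\<Sum>x\<in>insert y X. c' x * u a0 x m) = 0"
      using c insert.hyps by (simp add: w_sum) (simp add: c'_def algebra_simps)
    then have "\<forall>x\<in>insert y X. c' x = 0"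
      using insert.prems(2) unfolding independent_family_def by blast
    then have "u a0 y p * c x = 0" if "x \<in> X" for x
      using that insert.hyps by (metis c'_def insertCI)
    then show "\<forall>x\<in>X. c x = 0" using p by simp
  qed
  moreover have "polynomial_function n (\<lambda>a. w a x m)" if "x \<in> X" for x m
    unfolding w_def using that insert.prems(1) by (intro polynomial_function_intros) auto
  ultimately obtain f where f: "polynomial_function n f" "f a0 \<noteq> 0"
    "\<And>a. f a \<noteq> 0 \<Longrightarrow> independent_family X (w a)"
    using insert.IH[of w] by blast
  have "independent_family (insert y X) (u a)" if "f a * u a y p \<noteq> 0" for a
    unfolding independent_family_def
  proof (intro allI impI)
    fix c assume c: "\<forall>m. (\<Sum>x\<in>insert y X. c x * u a x m) = 0"
    then have c': "(\<Sum>x\<in>X. c x * u a x m) = - (c y * u a y m)" for m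
      using insert.hyps by (simp add: eq_neg_iff_add_eq_0 add.commute)
    then have "(\<Sum>x\<in>X. c x * w a x m) = 0" for m by (simp add: w_sum)
    then have X: "\<forall>x\<in>X. c x = 0" using f(3)[of a] that unfolding independent_family_def by auto
    with c'[of p] that have "c y = 0" by simp
    with X show "\<forall>x\<in>insert y X. c x = 0" by auto
  qed
  moreover have "polynomial_function n (\<lambda>a. f a * u a y p)"
    using f insert.prems(1) by (intro polynomial_function_intros) auto
  ultimately show ?case using f(2) p by (intro exI[of _ "\<lambda>a. f a * u a y p"]) auto
qed

section \<open>Green's and Macaulay's theorems\<close>

lemma lookup_poly_scale [simp]: "Poly_Mapping.lookup (poly_scale c p) m = c * Poly_Mapping.lookup p m"
proof -
  have "poly_scale c p = (\<Sum>m\<in>Poly_Mapping.keys p. Poly_Mapping.single m (c * Poly_Mapping.lookup p m))"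
  proof -
    have "Poly_Mapping.single 0 c * (\<Sum>m\<in>Poly_Mapping.keys p. Poly_Mapping.single m (Poly_Mapping.lookup p m)) =
      (\<Sum>m\<in>Poly_Mapping.keys p. Poly_Mapping.single m (c * Poly_Mapping.lookup p m))"
      by (simp add: sum_distrib_left mult_single)
    then show ?thesis by (simp add: sum_singles poly_scale_def)
  qed
  then show ?thesis
    by (auto simp: lookup_sum lookup_single when_def sum.delta in_keys_iff)
qed

lemma poly_scale_mult_left: "poly_scale c p * q = poly_scale c (p * q)"
  by (simp add: poly_scale_def mult.assoc)

lemma mono_degree_superset:
  assumes "finite A" "Poly_Mapping.keys m \<subseteq> A"
  shows "mono_degree m = (\<Sum>i\<in>A. Poly_Mapping.lookup m i)"
  unfolding mono_degree_def using assms by (intro sum.mono_neutral_left) (auto simp: in_keys_iff)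

lemma mono_degree_add: "mono_degree (m + m') = mono_degree m + mono_degree m'"
proof -
  define A where "A = Poly_Mapping.keys m \<union> Poly_Mapping.keys m'"
  have "finite A" "Poly_Mapping.keys m \<subseteq> A" "Poly_Mapping.keys m' \<subseteq> A" "Poly_Mapping.keys (m + m') \<subseteq> A"
    by (auto simp: A_def keys_add_nat)
  then show ?thesis by (simp add: mono_degree_superset[of A] lookup_add sum.distrib)
qed

lemma homogI:
  "(\<And>m. Poly_Mapping.lookup p m \<noteq> 0 \<Longrightarrow> Poly_Mapping.keys m \<subseteq> {..n} \<and> mono_degree m = d) \<Longrightarrow> p \<in> homog n d"
  by (auto simp: homog_def polys_def in_keys_iff)

lemma homogD:
  "p \<in> homog n d \<Longrightarrow> Poly_Mapping.lookup p m \<noteq> 0 \<Longrightarrow> Poly_Mapping.keys m \<subseteq> {..n} \<and> mono_degree m = d"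
  by (auto simp: homog_def polys_def in_keys_iff)

lemma homog_subset_polys: "homog n d \<subseteq> polys n"
  by (auto simp: homog_def)

lemma subspace_homog: "poly_vs.subspace (homog n d :: 'k::field mpoly set)"
  unfolding poly_vs.subspace_def
  by (auto intro!: homogI simp: lookup_add) (metis add.right_neutral homogD in_mono atMost_iff)+

lemma homog_mult:
  assumes "p \<in> homog n d" "q \<in> homog n e"
  shows "p * q \<in> homog n (d + e)"
  using assms polys_mult[of p n q] Poly_Mapping.keys_mult[of p q]
  by (fastforce simp: homog_def mono_degree_add)

lemma homog_single:
  "Poly_Mapping.keys m \<subseteq> {..n} \<Longrightarrow> mono_degree m = d \<Longrightarrow> Poly_Mapping.single m c \<in> homog n d"
  by (auto simp: homog_def polys_def)

lemma linear_form_homog: "linear_form n a \<in> homog n 1"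
proof -
  have "Poly_Mapping.keys (linear_form n a) \<subseteq> (\<Union>i\<in>{..n}. {Poly_Mapping.single i 1})"
    unfolding linear_form_def
    by (rule order.trans[OF Poly_Mapping.keys_sum]) auto
  then show ?thesis by (auto simp: homog_def polys_def mono_degree_def subset_iff)
qed

lemma linear_form_unit:
  "i \<le> n \<Longrightarrow> linear_form n (\<lambda>j. if j = i then 1 else 0) = Poly_Mapping.single (Poly_Mapping.single i 1) 1"
proof -
  assume "i \<le> n"
  have "linear_form n (\<lambda>j. if j = i then 1 else 0) =
     (\<Sum>j\<le>n. if j = i then Poly_Mapping.single (Poly_Mapping.single i 1) 1 else 0)"
    unfolding linear_form_def by (intro sum.cong) auto
  with \<open>i \<le> n\<close> show ?thesis by simp
qed

lemma finite_dim_homog: "poly_vs.finite_dim (homog n d :: 'k::field mpoly set)"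
proof -
  define M where "M = {m. Poly_Mapping.keys m \<subseteq> {..n} \<and> mono_degree m = d}"
  have "M \<subseteq> (\<lambda>f. \<Sum>i\<le>n. Poly_Mapping.single i (f i)) ` (PiE {..n} (\<lambda>_. {..d}))"
  proof
    fix m assume m: "m \<in> M"
    define f where "f = restrict (Poly_Mapping.lookup m) {..n}"
    have "Poly_Mapping.lookup m i \<le> d" if "i \<le> n" for i
      using m that mono_degree_superset[of "{..n}" m] member_le_sum[of i "{..n}" "Poly_Mapping.lookup m"]
      by (auto simp: M_def)
    then have "f \<in> PiE {..n} (\<lambda>_. {..d})" by (auto simp: f_def)
    moreover have "m = (\<Sum>i\<le>n. Poly_Mapping.single i (f i))"
    proof (rule poly_mapping_eqI)
      fix j
      have "Poly_Mapping.lookup m j = 0" if "\<not> j \<le> n"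
        using m that by (auto simp: M_def in_keys_iff subset_iff)
      then show "Poly_Mapping.lookup m j = Poly_Mapping.lookup (\<Sum>i\<le>n. Poly_Mapping.single i (f i)) j"
        by (auto simp: lookup_sum lookup_single when_def f_def)
    qed
    ultimately show "m \<in> (\<lambda>f. \<Sum>i\<le>n. Poly_Mapping.single i (f i)) ` (PiE {..n} (\<lambda>_. {..d}))" by blast
  qed
  then have "finite M" by (rule finite_subset) (intro finite_imageI finite_PiE; simp)
  moreover have "homog n d \<subseteq> poly_vs.span ((\<lambda>m. Poly_Mapping.single m (1::'k)) ` M)"
  proof
    fix p :: "'k mpoly" assume p: "p \<in> homog n d"
    have "(\<Sum>m\<in>Poly_Mapping.keys p. Poly_Mapping.single m (Poly_Mapping.lookup p m))
       \<in> poly_vs.span ((\<lambda>m. Poly_Mapping.single m (1::'k)) ` M)"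
    proof (rule poly_vs.span_sum)
      fix m assume "m \<in> Poly_Mapping.keys p"
      then have "m \<in> M" using p by (auto simp: M_def homog_def polys_def)
      moreover have "Poly_Mapping.single m (Poly_Mapping.lookup p m) =
          poly_scale (Poly_Mapping.lookup p m) (Poly_Mapping.single m 1)"
        by (simp add: poly_scale_def mult_single)
      ultimately show "Poly_Mapping.single m (Poly_Mapping.lookup p m)
         \<in> poly_vs.span ((\<lambda>m. Poly_Mapping.single m (1::'k)) ` M)"
        by (metis poly_vs.span_scale poly_vs.span_base imageI)
    qed
    then show "p \<in> poly_vs.span ((\<lambda>m. Poly_Mapping.single m (1::'k)) ` M)" by (simp add: sum_singles)
  qed
  ultimately show ?thesis unfolding poly_vs.finite_dim_def by blast
qed

lemma module_hom_mult_right: "module_hom poly_scale poly_scale (\<lambda>g. g * (h :: 'k::field mpoly))"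
  by (simp add: module_hom_iff poly_vs.module_axioms ring_distribs poly_scale_mult_left)

lemma homog_eq_generated:
  fixes V :: "'k::field mpoly set"
  assumes "d > 0" "poly_vs.subspace V"
    and mult: "\<And>i g. i \<le> n \<Longrightarrow> g \<in> homog n (d - 1) \<Longrightarrow> g * Poly_Mapping.single (Poly_Mapping.single i 1) 1 \<in> V"
  shows "homog n d \<subseteq> V"
proof
  fix p :: "'k mpoly" assume p: "p \<in> homog n d"
  have "(\<Sum>m\<in>Poly_Mapping.keys p. Poly_Mapping.single m (Poly_Mapping.lookup p m)) \<in> V"
  proof (rule poly_vs.subspace_sum[OF assms(2)])
    fix m assume "m \<in> Poly_Mapping.keys p"
    then have m: "Poly_Mapping.keys m \<subseteq> {..n}" "mono_degree m = d"
      using p by (auto simp: homog_def polys_def)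
    then obtain i where i: "i \<in> Poly_Mapping.keys m" using \<open>d > 0\<close> by (fastforce simp: mono_degree_def)
    define m' where "m' = m - Poly_Mapping.single i 1"
    have mm': "m = m' + Poly_Mapping.single i 1"
      using i by (intro poly_mapping_eqI) (auto simp: m'_def lookup_add lookup_minus lookup_single when_def in_keys_iff)
    have "Poly_Mapping.keys m' \<subseteq> {..n}" using m(1) unfolding mm' keys_add_nat by auto
    moreover have "mono_degree m' = d - 1"
      using m(2) unfolding mm' mono_degree_add by (simp add: mono_degree_def)
    ultimately have "Poly_Mapping.single m' (Poly_Mapping.lookup p m) *
        Poly_Mapping.single (Poly_Mapping.single i 1) 1 \<in> V"
      using i m by (intro mult homog_single) auto
    then show "Poly_Mapping.single m (Poly_Mapping.lookup p m) \<in> V"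
      unfolding mult_single mm'[symmetric] by simp
  qed
  then show "p \<in> V" by (simp add: sum_singles)
qed

definition restr :: "nat \<Rightarrow> nat \<Rightarrow> 'k::field mpoly set \<Rightarrow> 'k mpoly \<Rightarrow> 'k mpoly set" where
  "restr n d W h = {w + g * h | w g. w \<in> W \<and> g \<in> homog n (d - 1)}"

definition colon :: "nat \<Rightarrow> nat \<Rightarrow> 'k::field mpoly set \<Rightarrow> 'k mpoly \<Rightarrow> 'k mpoly set" where
  "colon n d W h = {g \<in> homog n (d - 1). g * h \<in> W}"

definition codim :: "nat \<Rightarrow> nat \<Rightarrow> 'k::field mpoly set \<Rightarrow> nat" where
  "codim n d V = poly_vs.dim (homog n d :: 'k mpoly set) - poly_vs.dim V"

text \<open>One graded piece rather than an ideal: Green's theorem concerns a single degree, and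
  \<open>restr\<close> and \<open>colon\<close> lead from pieces to pieces.\<close>

definition graded_subspace :: "nat \<Rightarrow> nat \<Rightarrow> 'k::field mpoly set \<Rightarrow> bool" where
  "graded_subspace n d V \<longleftrightarrow> poly_vs.subspace V \<and> V \<subseteq> homog n d"

lemma graded_subspaceD:
  fixes V :: "'k::field mpoly set"
  assumes "graded_subspace n d V"
  shows "poly_vs.subspace V" "V \<subseteq> homog n d" "poly_vs.finite_dim V"
    "poly_vs.dim V \<le> poly_vs.dim (homog n d :: 'k mpoly set)"
  using assms poly_vs.finite_dim_subset[OF finite_dim_homog] poly_vs.dim_subset_finite[OF _ finite_dim_homog]
  unfolding graded_subspace_def by blast+

lemma subset_restr: "W \<subseteq> restr n d W (h :: 'k::field mpoly)"
proof
  fix w assume "w \<in> W"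
  then have "w = w + 0 * h" "w \<in> W" "(0 :: 'k mpoly) \<in> homog n (d - 1)" by (auto intro: homogI)
  then show "w \<in> restr n d W h" unfolding restr_def by blast
qed

lemma graded_subspace_restr:
  assumes "d > 0" "graded_subspace n d W" "h \<in> homog n 1"
  shows "graded_subspace n d (restr n d W h)"
proof -
  interpret f: module_hom poly_scale poly_scale "\<lambda>g. g * h" by (rule module_hom_mult_right)
  have "restr n d W h = {x + y | x y. x \<in> W \<and> y \<in> (\<lambda>g. g * h) ` homog n (d - 1)}"
    unfolding restr_def by auto
  then have "poly_vs.subspace (restr n d W h)"
    using poly_vs.subspace_sums[OF graded_subspaceD(1)[OF assms(2)] f.subspace_image[OF subspace_homog]] by simp
  moreover have "restr n d W h \<subseteq> homog n d"
    using graded_subspaceD(2)[OF assms(2)] homog_mult[OF _ assms(3), of _ "d - 1"] assms(1)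
      poly_vs.subspace_add[OF subspace_homog] unfolding restr_def by fastforce
  ultimately show ?thesis by (simp add: graded_subspace_def)
qed

lemma graded_subspace_colon:
  assumes "graded_subspace n d W"
  shows "graded_subspace n (d - 1) (colon n d W h)"
  using graded_subspaceD(1)[OF assms] subspace_homog[of n "d - 1", where 'k = 'a]
  unfolding graded_subspace_def colon_def poly_vs.subspace_def
  by (auto simp: ring_distribs poly_scale_mult_left)

text \<open>Exactness of 0 -> R_{d-1}/(W : h) -> R_d/W -> R_d/(W + h R_{d-1}) -> 0, where the first
  map is multiplication by h.\<close>

lemma codim_restr_plus_colon:
  assumes "d > 0" "graded_subspace n d W" "h \<in> homog n 1"
  shows "codim n d (restr n d W h) + codim n (d - 1) (colon n d W h) = codim n d W"
proof -
  have dim_le: "poly_vs.dim W \<le> poly_vs.dim (restr n d W h)"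
    using poly_vs.dim_subset_finite[OF subset_restr graded_subspaceD(3)[OF graded_subspace_restr[OF assms]]] .
  have "poly_vs.dim (restr n d W h) + poly_vs.dim (colon n d W h) =
     poly_vs.dim W + poly_vs.dim (homog n (d - 1) :: 'a mpoly set)"
    unfolding restr_def colon_def
    using poly_vs.dim_sum_image_plus_dim_preimage[OF subspace_homog finite_dim_homog
        graded_subspaceD(1,3)[OF assms(2)] module_hom_mult_right] .
  then show ?thesis
    using graded_subspaceD(4)[OF assms(2)] graded_subspaceD(4)[OF graded_subspace_restr[OF assms]]
      graded_subspaceD(4)[OF graded_subspace_colon[OF assms(2), of h]] dim_le unfolding codim_def by linarith
qed

lemma codim_mono:
  assumes "graded_subspace n d W" "V \<subseteq> W"
  shows "codim n d W \<le> codim n d V"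
  unfolding codim_def using poly_vs.dim_subset_finite[OF assms(2) graded_subspaceD(3)[OF assms(1)]] by simp

lemma graded_subspace_eq:
  assumes "graded_subspace n d V" "graded_subspace n d W" "V \<subseteq> W" "codim n d V \<le> codim n d W"
  shows "V = W"
proof (rule poly_vs.subspace_eq_of_dim_ge[OF assms(3)])
  show "poly_vs.dim W \<le> poly_vs.dim V"
    using graded_subspaceD(4)[OF assms(1)] graded_subspaceD(4)[OF assms(2)] assms(4)
    unfolding codim_def by linarith
qed (use assms graded_subspaceD in blast)+

lemma graded_subspace_homog: "graded_subspace n d (homog n d)"
  by (simp add: graded_subspace_def subspace_homog)

lemma codim_homog [simp]: "codim n d (homog n d) = 0"
  by (simp add: codim_def)

lemma linear_form_conv_sum:
  "g * linear_form n a = (\<Sum>i\<le>n. poly_scale (a i) (g * Poly_Mapping.single (Poly_Mapping.single i 1) 1))"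
  unfolding linear_form_def sum_distrib_left
  by (intro sum.cong refl) (simp add: poly_scale_def mult_single mult.left_commute)

text \<open>Lower semicontinuity of rank: a basis at \<open>a0\<close> is deformed along with a, and
  its independence survives off a hypersurface.\<close>

lemma codim_restr_semicontinuous:
  fixes W :: "'k::field mpoly set"
  assumes "d > 0" "graded_subspace n d W"
  shows "for_general_linear_form n (\<lambda>h. codim n d (restr n d W h) \<le> codim n d (restr n d W (linear_form n a0)))"
proof -
  define h0 where "h0 = linear_form n a0"
  \<comment> \<open>The basis is drawn from this spanning set and not from the whole sum, so that
    each of its vectors is in W or a multiple of \<open>h0\<close> and can follow a change of the
    form.\<close>
  define S where "S = W \<union> (\<lambda>g. g * h0) ` homog n (d - 1)"
  interpret f: module_hom poly_scale poly_scale "\<lambda>g. g * h0" by (rule module_hom_mult_right)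
  have gr: "graded_subspace n d (restr n d W (linear_form n a))" for a
    using assms by (intro graded_subspace_restr linear_form_homog)
  have span_S: "poly_vs.span S = restr n d W h0"
    unfolding S_def poly_vs.span_Un f.span_image restr_def
    using graded_subspaceD(1)[OF assms(2)] subspace_homog[of n "d - 1", where 'k = 'k]
    by (auto simp: poly_vs.span_eq_iff[THEN iffD2])
  have S: "S \<subseteq> restr n d W h0" using span_S poly_vs.span_superset by blast
  obtain B where B: "B \<subseteq> S" "poly_vs.independent B" "S \<subseteq> poly_vs.span B"
    by (rule poly_vs.maximal_independent_subset)
  have finB: "finite B"
    using poly_vs.independent_card_le_dim_finite(1)[OF B(2) _ graded_subspaceD(3)[OF gr[of a0]]] B S
    unfolding h0_def by blast
  have "restr n d W h0 \<subseteq> poly_vs.span B"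
    using B(3) poly_vs.span_minimal[OF B(3) poly_vs.subspace_span] span_S by blast
  then have cardB: "card B = poly_vs.dim (restr n d W h0)"
    using B S by (intro poly_vs.basis_card_eq_dim) auto
  define q where "q b = (SOME g. g \<in> homog n (d - 1) \<and> g * h0 = b)" for b
  have q: "q b \<in> homog n (d - 1) \<and> q b * h0 = b" if "b \<in> B" "b \<notin> W" for b
    unfolding q_def by (rule someI_ex) (use that B in \<open>auto simp: S_def\<close>)
  define v where "v a b = (if b \<in> W then b else q b * linear_form n a)" for a b
  have v0: "v a0 b = b" if "b \<in> B" for b
    using q that by (auto simp: v_def h0_def)
  have v: "v a b \<in> restr n d W (linear_form n a)" if "b \<in> B" for a b
  proof (cases "b \<in> W")
    case False
    have "q b * linear_form n a = 0 + q b * linear_form n a" by simp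
    moreover have "0 \<in> W" using poly_vs.subspace_0[OF graded_subspaceD(1)[OF assms(2)]] .
    ultimately have "q b * linear_form n a \<in> restr n d W (linear_form n a)"
      using q[OF that False] unfolding restr_def by blast
    then show ?thesis using False by (simp add: v_def)
  qed (use subset_restr in \<open>simp add: v_def subset_iff; blast\<close>)
  have pf: "polynomial_function n (\<lambda>a. Poly_Mapping.lookup (v a b) m)" for b m
    unfolding v_def linear_form_conv_sum
    by (cases "b \<in> W") (auto simp: lookup_sum intro!: polynomial_function_intros)
  have comb: "(\<forall>m. (\<Sum>b\<in>B. c b * Poly_Mapping.lookup (v a b) m) = 0) \<longleftrightarrow> (\<Sum>b\<in>B. poly_scale (c b) (v a b)) = 0"
    for c a
    by (simp add: poly_mapping_eq_iff fun_eq_iff lookup_sum)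
  have "independent_family B (\<lambda>b. Poly_Mapping.lookup (v a0 b))"
    unfolding independent_family_def comb
  proof (intro allI impI)
    fix c assume "(\<Sum>b\<in>B. poly_scale (c b) (v a0 b)) = 0"
    then have "(\<Sum>b\<in>B. poly_scale (c b) b) = 0" using v0 by simp
    then show "\<forall>b\<in>B. c b = 0"
      using B(2) finB unfolding poly_vs.independent_explicit_finite_subsets by blast
  qed
  from independent_family_open[OF finB pf this] obtain F where F: "F \<in> polys n" "eval_mpoly F a0 \<noteq> 0"
    "\<And>a. eval_mpoly F a \<noteq> 0 \<Longrightarrow> independent_family B (\<lambda>b. Poly_Mapping.lookup (v a b))"
    unfolding polynomial_function_def by metis
  have "codim n d (restr n d W (linear_form n a)) \<le> codim n d (restr n d W (linear_form n a0))"
    if "eval_mpoly F a \<noteq> 0" for a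
  proof -
    have ind: "\<forall>b\<in>B. c b = 0" if "(\<Sum>b\<in>B. poly_scale (c b) (v a b)) = 0" for c
      using F(3)[OF \<open>eval_mpoly F a \<noteq> 0\<close>] that unfolding independent_family_def comb by blast
    have inj: "inj_on (v a) B"
    proof (rule inj_onI, rule ccontr)
      fix x y assume xy: "x \<in> B" "y \<in> B" "v a x = v a y" "x \<noteq> y"
      have "(\<Sum>b\<in>B. poly_scale (if b = x then 1 else if b = y then -1 else 0) (v a b)) =
         (\<Sum>b\<in>{x, y}. poly_scale (if b = x then 1 else if b = y then -1 else 0) (v a b))"
        using xy finB by (intro sum.mono_neutral_right) auto
      also have "\<dots> = 0" using xy by simp
      finally show False using ind xy by fastforce
    qed
    have "poly_vs.independent (v a ` B)"
    proof (rule poly_vs.independent_if_scalars_zero)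
      fix c x assume "(\<Sum>x\<in>v a ` B. poly_scale (c x) x) = 0" "x \<in> v a ` B"
      then show "c x = 0" using ind[of "\<lambda>b. c (v a b)"] by (auto simp: sum.reindex[OF inj])
    qed (use finB in auto)
    then have "card (v a ` B) \<le> poly_vs.dim (restr n d W (linear_form n a))"
      using poly_vs.independent_card_le_dim_finite(2) graded_subspaceD(3)[OF gr] v by blast
    then show ?thesis using cardB card_image[OF inj] by (simp add: codim_def h0_def)
  qed
  moreover have "F \<noteq> 0" using F(2) by auto
  ultimately show ?thesis unfolding for_general_linear_form_def using F(1) by blast
qed

text \<open>If no form lowered the codimension, W would contain the products of R_{d-1} with all
  variables, hence R_d. This is what lets the induction on the codimension advance.\<close>

lemma ex_codim_restr_less:
  fixes W :: "'k::field mpoly set"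
  assumes "d > 0" "graded_subspace n d W" "codim n d W > 0"
  shows "\<exists>a. codim n d (restr n d W (linear_form n a)) < codim n d W"
proof (rule ccontr)
  assume neg: "\<not> ?thesis"
  have "restr n d W (linear_form n a) = W" for a
    using neg assms by (intro graded_subspace_eq[symmetric, of n d] graded_subspace_restr
      linear_form_homog subset_restr) (auto simp: not_less)
  then have "g * linear_form n a \<in> W" if "g \<in> homog n (d - 1)" for g a
    using that poly_vs.subspace_0[OF graded_subspaceD(1)[OF assms(2)]]
    unfolding restr_def by (metis (mono_tags, lifting) add.left_neutral mem_Collect_eq)
  then have "homog n d \<subseteq> W"
    using homog_eq_generated[OF assms(1) graded_subspaceD(1)[OF assms(2)], of n] linear_form_unit by metis
  then have "W = homog n d" using graded_subspaceD(2)[OF assms(2)] by blast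
  with assms show False by simp
qed

text \<open>
  Green's hyperplane restriction theorem. The double induction on the degree and on the
  codimension of \<open>W\<close> replaces the usual induction on the number of variables: the hyperplane
  section \<open>restr n d W h\<close> stays in the same ring but has smaller codimension.
\<close>

theorem green_restriction:
  fixes W :: "'k::field_char_0 mpoly set"
  assumes "d > 0" "graded_subspace n d W"
  shows "for_general_linear_form n (\<lambda>h. codim n d (restr n d W h) \<le> low d (codim n d W))"
  using assms
proof (induction d arbitrary: W)
  case (Suc e)
  define d where "d = Suc e"
  have d: "d > 0" by (simp add: d_def)
  have "graded_subspace n d W" using Suc by (simp add: d_def)
  then have "for_general_linear_form n (\<lambda>h. codim n d (restr n d W h) \<le> low d (codim n d W))"
  proof (induction "codim n d W" arbitrary: W rule: less_induct)
    case (less W)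
    define c where "c = codim n d W"
    note W = \<open>graded_subspace n d W\<close>
    \<comment> \<open>The minimum over all forms; by semicontinuity it is also the general
      value.\<close>
    define m where "m = (LEAST k. \<exists>a. codim n d (restr n d W (linear_form n a)) = k)"
    have "\<exists>k a. codim n d (restr n d W (linear_form n a)) = k" by blast
    from LeastI_ex[OF this] obtain a0 where a0: "codim n d (restr n d W (linear_form n a0)) = m"
      unfolding m_def by blast
    have m_le: "m \<le> codim n d (restr n d W (linear_form n a))" for a
      unfolding m_def by (rule Least_le) blast
    have gen_m: "for_general_linear_form n (\<lambda>h. codim n d (restr n d W h) \<le> m)"
      using codim_restr_semicontinuous[OF d W, of a0] a0 by simp
    have "m \<le> low d c"
    proof (cases "c = 0")
      case True
      have "m \<le> c" using a0 codim_mono[OF graded_subspace_restr[OF d W linear_form_homog] subset_restr]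
        unfolding c_def by metis
      then show ?thesis using True by simp
    next
      case False
      then have "m < c"
        using ex_codim_restr_less[OF d W] m_le unfolding c_def by (metis le_less_trans neq0_conv)
      show ?thesis
      proof (cases "e = 0")
        case True
        have "expansion 1 c = [c - 1]" using False by (intro expansion_eq) auto
        then show ?thesis using \<open>m < c\<close> True by (simp add: low_def d_def)
      next
        case e: False
        \<comment> \<open>\<open>h0\<close> attains m and stays fixed; the general form
          \<open>h1\<close> below attains m as well. Splitting V = W + h1 R_{d-1} along
          \<open>h0\<close> bounds m by the restrictions to \<open>h1\<close> of W + h0 R_{d-1}, of
          smaller codimension, and of W : h0, of smaller degree. Both induction hypotheses
          apply.\<close>
        define h0 where "h0 = linear_form n a0"
        have h0: "h0 \<in> homog n 1" unfolding h0_def by (rule linear_form_homog)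
        have colon: "codim n e (colon n d W h0) = c - m" "graded_subspace n e (colon n d W h0)"
          using codim_restr_plus_colon[OF d W h0] a0 graded_subspace_colon[OF W, of h0]
          by (auto simp: h0_def c_def d_def)
        have restr: "graded_subspace n d (restr n d W h0)" "codim n d (restr n d W h0) = m"
          using graded_subspace_restr[OF d W h0] a0 by (simp_all add: h0_def)
        have "for_general_linear_form n (\<lambda>h. codim n e (restr n e (colon n d W h0) h) \<le> low e (c - m))"
          using Suc.IH[OF _ colon(2)] e colon(1) by simp
        moreover have "for_general_linear_form n (\<lambda>h. codim n d (restr n d (restr n d W h0) h) \<le> low d m)"
          using less.hyps[OF _ restr(1)] restr(2) \<open>m < c\<close> by (simp add: c_def)
        ultimately have "for_general_linear_form n (\<lambda>h. codim n d (restr n d W h) \<le> m \<and>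
            codim n e (restr n e (colon n d W h0) h) \<le> low e (c - m) \<and>
            codim n d (restr n d (restr n d W h0) h) \<le> low d m)"
          using gen_m by (intro for_general_conj)
        then obtain a1 where a1: "codim n d (restr n d W (linear_form n a1)) \<le> m"
          "codim n e (restr n e (colon n d W h0) (linear_form n a1)) \<le> low e (c - m)"
          "codim n d (restr n d (restr n d W h0) (linear_form n a1)) \<le> low d m"
          using for_general_ex by blast
        define h1 where "h1 = linear_form n a1"
        have h1: "h1 \<in> homog n 1" unfolding h1_def by (rule linear_form_homog)
        define V where "V = restr n d W h1"
        have V: "graded_subspace n d V" unfolding V_def by (rule graded_subspace_restr[OF d W h1])
        have "codim n d V = m" using a1(1) m_le[of a1] by (simp add: V_def h1_def)
        moreover have "restr n d (restr n d W h0) h1 \<subseteq> restr n d V h0"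
        proof
          fix f assume "f \<in> restr n d (restr n d W h0) h1"
          then obtain w g g' where "w \<in> W" "g \<in> homog n (d - 1)" "g' \<in> homog n (d - 1)" "f = (w + g * h0) + g' * h1"
            unfolding restr_def by blast
          moreover from this have "f = (w + g' * h1) + g * h0" by (simp add: algebra_simps)
          ultimately show "f \<in> restr n d V h0" unfolding V_def restr_def by blast
        qed
        then have "codim n d (restr n d V h0) \<le> low d m"
          using order.trans[OF codim_mono[OF graded_subspace_restr[OF d V h0]] a1(3)[folded h1_def]] by blast
        moreover have "restr n e (colon n d W h0) h1 \<subseteq> colon n d V h0"
        proof
          fix f assume "f \<in> restr n e (colon n d W h0) h1"
          then obtain g k where g: "g \<in> homog n e" "g * h0 \<in> W" and k: "k \<in> homog n (e - 1)" and f: "f = g + k * h1"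
            by (auto simp: restr_def colon_def d_def)
          have "k * h1 \<in> homog n e" using homog_mult[OF k h1] e by simp
          then have "f \<in> homog n e" using g f poly_vs.subspace_add[OF subspace_homog] by blast
          moreover have "f * h0 = g * h0 + (k * h0) * h1" by (simp add: f algebra_simps)
          moreover have "k * h0 \<in> homog n (d - 1)" using homog_mult[OF k h0] e by (simp add: d_def)
          ultimately show "f \<in> colon n d V h0"
            using g unfolding colon_def V_def restr_def by (auto simp: d_def)
        qed
        then have "codim n e (colon n d V h0) \<le> low e (c - m)"
          using order.trans[OF codim_mono a1(2)[folded h1_def]] graded_subspace_colon[OF V, of h0]
          by (simp add: d_def)
        ultimately have "m \<le> low d m + low e (c - m)"
          using codim_restr_plus_colon[OF d V h0] by (simp add: d_def)
        then show ?thesis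
          using le_low_of_restriction[of d m c] \<open>m < c\<close> e by (simp add: d_def)
      qed
    qed
    with gen_m show ?case unfolding c_def by (auto elim: for_general_mono)
  qed
  then show ?case by (simp add: d_def)
qed simp

text \<open>V lies in W : h for every h, so its codimension bounds one term of
  \<open>codim_restr_plus_colon\<close>; Green's theorem for one suitable h bounds the
  other.\<close>

theorem macaulay_growth:
  fixes V W :: "'k::field_char_0 mpoly set"
  assumes "d > 0" "graded_subspace n d W" "\<And>v a. v \<in> V \<Longrightarrow> v * linear_form n a \<in> W"
    and V: "V \<subseteq> homog n (d - 1)"
  shows "codim n d W \<le> codim n (d - 1) V + low d (codim n d W)"
proof -
  obtain a where a: "codim n d (restr n d W (linear_form n a)) \<le> low d (codim n d W)"
    using for_general_ex[OF green_restriction[OF assms(1,2)]] by blast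
  have "codim n (d - 1) (colon n d W (linear_form n a)) \<le> codim n (d - 1) V"
    using assms V by (intro codim_mono graded_subspace_colon) (auto simp: colon_def)
  with a codim_restr_plus_colon[OF assms(1,2) linear_form_homog, of a] show ?thesis by linarith
qed

section \<open>Hilbert functions of saturated ideals\<close>

lemma polys_1 [simp]: "1 \<in> polys n"
  by (simp add: polys_def)

lemma graded_subspace_piece:
  assumes "ideal_in n J"
  shows "graded_subspace n t (J \<inter> homog n t)"
proof -
  have "poly_vs.subspace J"
    using assms unfolding poly_vs.subspace_def ideal_in_def poly_scale_def by (simp add: polys_single)
  then show ?thesis
    unfolding graded_subspace_def by (auto intro: poly_vs.subspace_inter subspace_homog)
qed

lemma hilbert_eq_codim: "hilbert n J t = codim n t (J \<inter> homog n t)"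
  by (simp add: hilbert_def codim_def)

lemma ideal_in_mult: "ideal_in n J \<Longrightarrow> f \<in> J \<Longrightarrow> g \<in> polys n \<Longrightarrow> g * f \<in> J"
  by (simp add: ideal_in_def)

lemma ideal_in_add_principal:
  fixes I :: "'k::comm_ring_1 mpoly set"
  assumes "ideal_in n I" "h \<in> polys n"
  shows "ideal_in n (add_principal n I h)"
  unfolding ideal_in_def
proof (intro conjI ballI)
  show "add_principal n I h \<subseteq> polys n"
    using assms by (auto simp: add_principal_def ideal_in_def intro!: polys_add polys_mult)
  have "(0 :: 'k mpoly) = 0 + 0 * h" by simp
  then show "0 \<in> add_principal n I h"
    using assms unfolding add_principal_def ideal_in_def by (metis (mono_tags, lifting) mem_Collect_eq polys_0)
next
  fix f g assume "f \<in> add_principal n I h" "g \<in> add_principal n I h"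
  then obtain f1 f2 g1 g2 where fg: "f1 \<in> I" "f2 \<in> polys n" "f = f1 + f2 * h" "g1 \<in> I" "g2 \<in> polys n" "g = g1 + g2 * h"
    unfolding add_principal_def by blast
  then have "f + g = (f1 + g1) + (f2 + g2) * h" by (simp add: algebra_simps)
  moreover have "f1 + g1 \<in> I" "f2 + g2 \<in> polys n" using assms fg by (auto simp: ideal_in_def polys_add)
  ultimately show "f + g \<in> add_principal n I h" unfolding add_principal_def by blast
next
  fix f g :: "'k mpoly" assume "f \<in> add_principal n I h" and g: "g \<in> polys n"
  then obtain f1 f2 where f: "f1 \<in> I" "f2 \<in> polys n" "f = f1 + f2 * h"
    unfolding add_principal_def by blast
  then have "g * f = g * f1 + (g * f2) * h" by (simp add: algebra_simps)
  moreover have "g * f1 \<in> I" "g * f2 \<in> polys n" using assms f g by (auto simp: ideal_in_mult polys_mult)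
  ultimately show "g * f \<in> add_principal n I h" unfolding add_principal_def by blast
qed

lemma lookup_homog_component:
  "Poly_Mapping.lookup (homog_component t p) m = (if mono_degree m = t then Poly_Mapping.lookup p m else 0)"
  by (auto simp: homog_component_def lookup_sum lookup_single when_def in_keys_iff)

lemma homog_component_add: "homog_component t (p + q) = homog_component t p + homog_component t q"
  by (rule poly_mapping_eqI) (simp add: lookup_homog_component lookup_add)

lemma homog_component_homog: "p \<in> polys n \<Longrightarrow> homog_component t p \<in> homog n t"
  by (rule homogI) (auto simp: lookup_homog_component polys_def in_keys_iff split: if_splits)

lemma homog_component_self: "p \<in> homog n t \<Longrightarrow> homog_component t p = p"
  by (rule poly_mapping_eqI) (auto simp: lookup_homog_component dest: homogD)

lemma homog_component_mult_linear:
  fixes g h :: "'k::comm_ring_1 mpoly"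
  assumes g: "g \<in> polys n" and h: "h \<in> homog n 1" and t: "t > 0"
  shows "homog_component t (g * h) = homog_component (t - 1) g * h"
proof -
  define r where "r = g - homog_component (t - 1) g"
  have "Poly_Mapping.lookup (r * h) m = 0" if m: "mono_degree m = t" for m
  proof (rule ccontr)
    assume "Poly_Mapping.lookup (r * h) m \<noteq> 0"
    then obtain m1 m2 where "m = m1 + m2" "Poly_Mapping.lookup r m1 \<noteq> 0" "Poly_Mapping.lookup h m2 \<noteq> 0"
      using Poly_Mapping.keys_mult[of r h] by (fastforce simp: in_keys_iff)
    moreover from this have "mono_degree m2 = 1" using homogD[OF h] by blast
    ultimately show False
      using m by (auto simp: mono_degree_add r_def lookup_minus lookup_homog_component)
  qed
  then have "homog_component t (r * h) = 0"
    by (intro poly_mapping_eqI) (simp add: lookup_homog_component)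
  moreover have "homog_component (t - 1) g * h \<in> homog n t"
    using homog_mult[OF homog_component_homog[OF g] h, of "t - 1"] t by simp
  moreover have "g * h = homog_component (t - 1) g * h + r * h"
    by (simp add: r_def algebra_simps)
  ultimately show ?thesis by (simp add: homog_component_add homog_component_self)
qed

text \<open>Links I + hR to the subspaces of Green's theorem: as I and h are homogeneous, the degree
  t component of f + g h is again of this form.\<close>

lemma add_principal_piece:
  assumes I: "homogeneous_ideal n I" and h: "h \<in> homog n 1" and t: "t > 0"
  shows "add_principal n I h \<inter> homog n t = restr n t (I \<inter> homog n t) h"
proof
  show "add_principal n I h \<inter> homog n t \<subseteq> restr n t (I \<inter> homog n t) h"
  proof
    fix p assume "p \<in> add_principal n I h \<inter> homog n t"
    then obtain f g where fg: "f \<in> I" "g \<in> polys n" "p = f + g * h" and p: "p \<in> homog n t"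
      unfolding add_principal_def by blast
    have "f \<in> polys n" using fg I by (auto simp: homogeneous_ideal_def ideal_in_def)
    then have "homog_component t f \<in> I \<inter> homog n t" "homog_component (t - 1) g \<in> homog n (t - 1)"
      using I fg by (auto simp: homogeneous_ideal_def homog_component_homog)
    moreover have "p = homog_component t f + homog_component (t - 1) g * h"
      using homog_component_self[OF p] homog_component_mult_linear[OF fg(2) h t]
      by (simp add: fg(3) homog_component_add)
    ultimately show "p \<in> restr n t (I \<inter> homog n t) h" unfolding restr_def by blast
  qed
  have "restr n t (I \<inter> homog n t) h \<subseteq> homog n t"
    using graded_subspace_restr[OF t graded_subspace_piece h] I graded_subspaceD(2)
    unfolding homogeneous_ideal_def by blast
  then show "restr n t (I \<inter> homog n t) h \<subseteq> add_principal n I h \<inter> homog n t"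
    using homog_subset_polys unfolding restr_def add_principal_def by blast
qed

text \<open>Macaulay's bound rewritten by Pascal's rule: H(t) - H(t)_<t> is the difference set of
  H(t) read in degree t - 1.\<close>

lemma hilbert_macaulay:
  fixes J :: "'k::field_char_0 mpoly set"
  assumes "ideal_in n J" "t > 0"
  shows "mval (t - 1) (expansion t (hilbert n J t)) \<le> hilbert n J (t - 1)"
proof -
  have "hilbert n J t \<le> hilbert n J (t - 1) + low t (hilbert n J t)"
    unfolding hilbert_eq_codim
  proof (rule macaulay_growth[OF assms(2) graded_subspace_piece[OF assms(1)]])
    fix v :: "'k mpoly" and a assume v: "v \<in> J \<inter> homog n (t - 1)"
    have "v * linear_form n a \<in> homog n t" using homog_mult[OF _ linear_form_homog, of v n "t - 1"] v assms(2) by simp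
    moreover have "linear_form n a * v \<in> J"
      using v linear_form_homog homog_subset_polys by (intro ideal_in_mult[OF assms(1)]) blast+
    ultimately show "v * linear_form n a \<in> J \<inter> homog n t" by (simp add: mult.commute)
  qed auto
  with low_pascal[OF assms(2), of "hilbert n J t"] show ?thesis by linarith
qed

text \<open>The expansion in degree t + 1 can have t + 1 entries, the case for which
  \<open>mval_strict_mono\<close> admits a surplus entry.\<close>

lemma expansion_hilbert_decreasing:
  fixes J :: "'k::field_char_0 mpoly set"
  assumes "ideal_in n J" "t > 0"
  shows "lex_le (expansion (Suc t) (hilbert n J (Suc t))) (expansion t (hilbert n J t))"
proof (rule ccontr)
  assume "\<not> ?thesis"
  from mval_strict_mono[OF this, of t]
  have "hilbert n J t < mval t (expansion (Suc t) (hilbert n J (Suc t)))"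
    using expansion_props[of t] expansion_props[of "Suc t"] assms by auto
  with hilbert_macaulay[OF assms(1), of "Suc t"] show False by simp
qed

lemma expansion_hilbert_stabilizes:
  fixes J :: "'k::field_char_0 mpoly set"
  assumes "ideal_in n J"
  shows "\<exists>t0\<ge>1. \<exists>T. \<forall>t\<ge>t0. expansion t (hilbert n J t) = T"
proof -
  have "\<exists>t1\<ge>1. \<forall>t\<ge>t1. expansion t (hilbert n J t) = expansion t1 (hilbert n J t1)"
    by (rule lex_decreasing_stabilizes)
       (simp_all add: expansion_props expansion_hilbert_decreasing[OF assms])
  then show ?thesis by blast
qed

text \<open>If I contained R_t, saturation applied to 1 would give I = R. Positivity makes
  \<open>macaulay_set\<close> and \<open>macaulay_lower\<close> meaningful.\<close>

lemma hilbert_pos: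
  assumes "nonempty_closed_subscheme n I"
  shows "hilbert n I t > 0"
proof (rule ccontr)
  assume zero: "\<not> ?thesis"
  have I: "ideal_in n I" "saturated n I" "I \<noteq> polys n"
    using assms by (auto simp: nonempty_closed_subscheme_def homogeneous_ideal_def)
  have "I \<inter> homog n t = homog n t"
    using zero unfolding hilbert_eq_codim
    by (intro graded_subspace_eq[OF graded_subspace_piece[OF I(1)] graded_subspace_homog]) auto
  then have "\<forall>g\<in>homog n t. g * 1 \<in> I" by auto
  then have "1 \<in> I" using I(2) unfolding saturated_def by (metis polys_1)
  then have "polys n \<subseteq> I" using ideal_in_mult[OF I(1)] by (metis mult.right_neutral subsetI)
  with I show False unfolding ideal_in_def by blast
qed

text \<open>Green's bound in the single degree t0 + 1 already makes h a nonzerodivisor modulo I, so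
  one open condition settles all degrees.\<close>

lemma hilbert_general_section_eventually:
  fixes I :: "'k::field_char_0 mpoly set"
  assumes I: "homogeneous_ideal n I" "saturated n I"
    and t0: "t0 \<ge> 1" and T: "\<And>t. t \<ge> t0 \<Longrightarrow> expansion t (hilbert n I t) = T"
  shows "for_general_linear_form n (\<lambda>h.
    (\<forall>t>t0. hilbert n (add_principal n I h) t = low t (hilbert n I t)) \<and>
    (\<forall>t\<ge>1. hilbert n I t = hilbert n I (t - 1) + hilbert n (add_principal n I h) t))"
proof -
  \<comment> \<open>The first degree for which H(d) and H(d - 1) are both known to be values of
    T.\<close>
  define d where "d = Suc t0"
  have ideal: "ideal_in n I" using I by (simp add: homogeneous_ideal_def)
  note gr = graded_subspace_piece[OF ideal]
  define H where "H = hilbert n I"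
  have T_props: "desc T" "length T \<le> t0" using expansion_props(1,2)[of t0 "hilbert n I t0"] T t0 by auto
  have H: "H t = mval t T" if "t \<ge> t0" for t
    using expansion_props(3)[of t "H t"] T[OF that] that t0 by (simp add: H_def)
  have low_H: "low t (H t) = mlow t T" if "t \<ge> t0" for t
    using T[OF that] by (simp add: low_def H_def)
  have H_diff: "H t = mlow t T + H (t - 1)" if "t \<ge> d" for t
    using mval_pascal[of T t] H[of t] H[of "t - 1"] T_props that by (simp add: d_def)
  \<comment> \<open>The expansion of H(t)_<t>, the same list for all t \<ge> t0.\<close>
  define T' where "T' = map (\<lambda>a. a - 1) (filter (\<lambda>a. 0 < a) T)"
  have T': "desc T'" "length T' \<le> t0"
    using T_props sorted_wrt_filter[of "(\<ge>)" T "\<lambda>a. 0 < a"]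
    by (auto simp: T'_def sorted_wrt_map intro: sorted_wrt_mono_rel[rotated] le_trans[OF length_filter_le])
  have mlow_T: "mlow t T = mval t T'" if "t \<ge> t0" for t
    unfolding T'_def using T_props that by (intro mlow_eq_mval) auto
  have "for_general_linear_form n (\<lambda>h. codim n d (restr n d (I \<inter> homog n d) h) \<le> low d (codim n d (I \<inter> homog n d)))"
    by (rule green_restriction[OF _ gr]) (simp add: d_def)
  then show ?thesis
  proof (rule for_general_mono)
    fix a :: "nat \<Rightarrow> 'k"
    define h where "h = linear_form n a"
    have h: "h \<in> homog n 1" unfolding h_def by (rule linear_form_homog)
    define J where "J = add_principal n I h"
    have J: "ideal_in n J"
      unfolding J_def using ideal h homog_subset_polys by (intro ideal_in_add_principal) auto
    have HJ: "hilbert n J t = codim n t (restr n t (I \<inter> homog n t) h)" if "t > 0" for t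
      unfolding hilbert_eq_codim J_def using add_principal_piece[OF I(1) h that] by simp
    have split: "hilbert n J t + codim n (t - 1) (colon n t (I \<inter> homog n t) h) = H t" if "t > 0" for t
      using codim_restr_plus_colon[OF that gr h] HJ[OF that] by (simp add: H_def hilbert_eq_codim)
    have I_sub: "I \<inter> homog n (t - 1) \<subseteq> colon n t (I \<inter> homog n t) h" if "t > 0" for t
    proof
      fix f assume f: "f \<in> I \<inter> homog n (t - 1)"
      have "f * h \<in> homog n t" using f homog_mult[OF _ h, of f "t - 1"] that by simp
      moreover have "h * f \<in> I" using f h homog_subset_polys by (intro ideal_in_mult[OF ideal]) blast+
      ultimately show "f \<in> colon n t (I \<inter> homog n t) h" using f by (simp add: colon_def mult.commute)
    qed
    assume green: "codim n d (restr n d (I \<inter> homog n d) (linear_form n a)) \<le> low d (codim n d (I \<inter> homog n d))"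
    \<comment> \<open>Macaulay's bound for J between t and t + 1 shows that the expansion of its
      value in degree t + 1 is at most T' lexicographically; hence T' bounds it there too.\<close>
    have upper: "hilbert n J t \<le> mlow t T" if "t \<ge> d" for t
      using that
    proof (induction t rule: dec_induct)
      case base
      have "hilbert n J d \<le> low d (H d)"
        using HJ[of d] green by (simp add: H_def hilbert_eq_codim h_def d_def)
      then show ?case using low_H[of d] by (simp add: d_def)
    next
      case (step t)
      define L where "L = expansion (Suc t) (hilbert n J (Suc t))"
      have L: "desc L" "length L \<le> Suc t" "mval (Suc t) L = hilbert n J (Suc t)"
        unfolding L_def by (simp_all add: expansion_props)
      have "mval t L \<le> mval t T'"
        using hilbert_macaulay[OF J, of "Suc t"] step mlow_T[of t] by (simp add: L_def d_def)
      then have "lex_le L T'"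
        using mval_strict_mono[of L T' t] T' L step by (fastforce simp: d_def)
      then have "mval (Suc t) L \<le> mval (Suc t) T'"
        using T' L step by (intro mval_mono) (auto simp: d_def)
      then show ?case using L mlow_T[of "Suc t"] step by (simp add: d_def)
    qed
    have nzd_ge: "colon n t (I \<inter> homog n t) h = I \<inter> homog n (t - 1)" if "t \<ge> d" for t
    proof -
      have "t > 0" using that by (simp add: d_def)
      have "H (t - 1) \<le> codim n (t - 1) (colon n t (I \<inter> homog n t) h)"
        using split[OF \<open>t > 0\<close>] upper[OF that] H_diff[OF that] by linarith
      then show ?thesis
        using graded_subspace_eq[OF gr graded_subspace_colon[OF gr] I_sub[OF \<open>t > 0\<close>]]
        by (simp add: H_def hilbert_eq_codim)
    qed
    have nzd: "colon n t (I \<inter> homog n t) h \<subseteq> I \<inter> homog n (t - 1)" if "t > 0" for t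
    proof
      fix f assume "f \<in> colon n t (I \<inter> homog n t) h"
      then have f: "f \<in> homog n (t - 1)" "f * h \<in> I" by (auto simp: colon_def)
      \<comment> \<open>Saturation reduces small degrees to large ones: after multiplication by any
        form of degree d, f lies in the colon in a degree covered by \<open>nzd_ge\<close>.\<close>
      have "g * f \<in> I" if g: "g \<in> homog n d" for g
      proof -
        have gf: "g * f \<in> homog n (d + (t - 1))" using homog_mult[OF g f(1)] .
        have "g * (f * h) \<in> I" using ideal_in_mult[OF ideal f(2), of g] g homog_subset_polys by blast
        moreover have "g * f * h \<in> homog n (d + t)" using homog_mult[OF gf h] \<open>t > 0\<close> by simp
        ultimately have "g * f \<in> colon n (d + t) (I \<inter> homog n (d + t)) h"
          using gf \<open>t > 0\<close> by (simp add: colon_def mult.assoc)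
        then show ?thesis using nzd_ge[of "d + t"] by simp
      qed
      then have "f \<in> I" using I(2) f homog_subset_polys unfolding saturated_def by blast
      with f show "f \<in> I \<inter> homog n (t - 1)" by simp
    qed
    have diff: "H t = H (t - 1) + hilbert n J t" if "t \<ge> 1" for t
    proof -
      have "colon n t (I \<inter> homog n t) h = I \<inter> homog n (t - 1)"
        using nzd[of t] I_sub[of t] that by (intro equalityI) auto
      then show ?thesis using split[of t] that by (simp add: H_def hilbert_eq_codim)
    qed
    have "hilbert n J t = low t (H t)" if "t > t0" for t
      using diff[of t] H_diff[of t] low_H[of t] that by (simp add: d_def)
    with diff show "(\<forall>t>t0. hilbert n (add_principal n I (linear_form n a)) t = low t (hilbert n I t)) \<and>
      (\<forall>t\<ge>1. hilbert n I t = hilbert n I (t - 1) + hilbert n (add_principal n I (linear_form n a)) t)"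
      unfolding H_def J_def h_def by blast
  qed
qed

section \<open>The Gotzmann difference set and the descent to degree 1\<close>

lemma gotzmann_set_eq:
  assumes "nonempty_closed_subscheme n I" "\<And>t. t \<ge> t0 \<Longrightarrow> expansion t (hilbert n I t) = T"
  shows "gotzmann_set n I = T"
  unfolding gotzmann_set_def
proof (rule the_equality)
  have *: "\<forall>\<^sub>F d in sequentially. macaulay_set d (hilbert n I d) = T"
    unfolding eventually_sequentially
    using assms(2) by (intro exI[of _ "Suc t0"]) (auto simp: macaulay_set_eq hilbert_pos[OF assms(1)])
  show "\<forall>\<^sub>F d in sequentially. macaulay_set d (hilbert n I d) = T" by (rule *)
  fix T' assume "\<forall>\<^sub>F d in sequentially. macaulay_set d (hilbert n I d) = T'"
  with * have "\<forall>\<^sub>F d :: nat in sequentially. T' = T" by eventually_elim simp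
  then show "T' = T" by simp
qed

theorem proposition3p6:
  fixes n :: nat and I :: "'k::{alg_closed_field, field_char_0} mpoly set"
  assumes "nonempty_closed_subscheme n I"
    and "M_number n I < gotzmann_number n I"
  shows "M_number n I = 1"
proof (rule ccontr)
  assume neq: "M_number n I \<noteq> 1"
  have I: "homogeneous_ideal n I" "saturated n I" and ideal: "ideal_in n I"
    using assms(1) by (auto simp: nonempty_closed_subscheme_def homogeneous_ideal_def)
  define H where "H = hilbert n I"
  define HJ where "HJ h = hilbert n (add_principal n I h)" for h :: "'k mpoly"
  define L where "L t = expansion t (H t)" for t
  define gen where "gen d \<longleftrightarrow> for_general_linear_form n (\<lambda>h. \<forall>t\<ge>d. HJ h t = low t (H t))" for d
  define m where "m = M_number n I"
  have M_pred: "(\<forall>t\<ge>d. hilbert n (add_principal n I h) t = macaulay_lower t (hilbert n I t)) \<longleftrightarrow>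
      (\<forall>t\<ge>d. HJ h t = low t (H t))" if "d \<ge> 1" for d h
    using that hilbert_pos[OF assms(1)] by (auto simp: macaulay_lower_eq HJ_def H_def)
  have m_Least: "m = (LEAST d. d \<ge> 1 \<and> gen d)"
    unfolding m_def M_number_def gen_def by (rule arg_cong[of _ _ Least]) (auto simp: M_pred)
  obtain t0 T where t0: "t0 \<ge> 1" and T: "\<And>t. t \<ge> t0 \<Longrightarrow> L t = T"
    using expansion_hilbert_stabilizes[OF ideal] unfolding L_def H_def by blast
  have general: "for_general_linear_form n (\<lambda>h. (\<forall>t>t0. HJ h t = low t (H t)) \<and>
      (\<forall>t\<ge>1. H t = H (t - 1) + HJ h t))"
    using hilbert_general_section_eventually[OF I t0] T unfolding L_def H_def HJ_def by blast
  have "gen (Suc t0)" unfolding gen_def using general by (rule for_general_mono) (blast dest: Suc_le_lessD)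
  then have "m \<ge> 1 \<and> gen m"
    unfolding m_Least using LeastI[of "\<lambda>d. d \<ge> 1 \<and> gen d" "Suc t0"] by simp
  with neq have m: "m \<ge> 2" "gen m" by (auto simp: m_def)
  have "length T = gotzmann_number n I"
    using gotzmann_set_eq[OF assms(1)] T unfolding gotzmann_number_def L_def H_def by blast
  then have m_less: "m < length T" using assms(2) by (simp add: m_def)
  have L: "desc (L t)" "length (L t) \<le> t" "mval t (L t) = H t" "low t (H t) = mlow t (L t)" if "t \<ge> 1" for t
    using that expansion_props[of t "H t"] by (auto simp: L_def low_def)

  obtain a where a: "\<forall>t\<ge>m. HJ (linear_form n a) t = low t (H t)"
    "\<forall>t\<ge>1. H t = H (t - 1) + HJ (linear_form n a) t"
    using for_general_ex[OF for_general_conj[OF m(2)[unfolded gen_def] general]] by blast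
  \<comment> \<open>For t \<ge> m the first difference of H is H(t)_<t>, so Pascal's rule leaves
    \<open>L t\<close> read in degree t - 1. This is the expansion of H(t - 1) unless
    \<open>L t\<close> has t entries.\<close>
  have descend: "H (t - 1) = mval (t - 1) (L t)" if "t \<ge> m" for t
  proof -
    have "H t = H (t - 1) + low t (H t)" using a that m by (metis le_trans one_le_numeral)
    then show ?thesis using low_pascal[of t "H t"] that m unfolding L_def by linarith
  qed
  \<comment> \<open>Downward induction from t0: T remains the expansion as long as it has at most t
    entries.\<close>
  have stable: "L t = T" if "t \<ge> m" "t \<ge> length T" for t
  proof (cases "t \<ge> t0")
    case False
    then have "t \<le> t0" by simp
    then show ?thesis using that
    proof (induction t rule: inc_induct)
      case (step t)
      then have "L (Suc t) = T" by simp
      then have "H t = mval t T" using descend[of "Suc t"] step by simp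
      then show ?case
        using L(1,2)[of "Suc t"] \<open>L (Suc t) = T\<close> step m unfolding L_def by (intro expansion_eq) auto
    qed (use T in auto)
  qed (use T in auto)
  \<comment> \<open>Once zero entries are gone, further descent cannot recreate them:
    \<open>low_mval\<close> covers both an unchanged list and one with a carry.\<close>
  have nonzero: "0 \<notin> set (L t)" if "t \<ge> m" "t < length T" for t
  proof -
    have "t \<le> length T - 1" using that by simp
    then show ?thesis using that
    proof (induction t rule: inc_induct)
      case base
      define d where "d = length T - 1"
      have "L (Suc d) = T" "Suc d = length T" using stable[of "Suc d"] m m_less by (auto simp: d_def)
      then have "H d = mval d T" using descend[of "Suc d"] m_less by (metis diff_Suc_1 less_imp_le)
      moreover have "desc T" using L(1)[of "Suc d"] \<open>L (Suc d) = T\<close> by simp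
      ultimately have "0 \<notin> set (L d)"
        using low_mval(2)[of d T] \<open>Suc d = length T\<close> m m_less by (simp add: L_def)
      then show ?case by (simp add: d_def)
    next
      case (step t)
      then have "0 \<notin> set (L (Suc t))" by simp
      moreover have "H t = mval t (L (Suc t))" using descend[of "Suc t"] step by simp
      ultimately show ?case
        using low_mval(2)[of t "L (Suc t)"] L(1,2)[of "Suc t"] step m by (simp add: L_def)
    qed
  qed
  \<comment> \<open>As \<open>L m\<close> has no zero entry, L' is the expansion of H(m)_<m>, and
    read in degree m - 1 it has the value \<open>mlow (m - 1) (L m)\<close>, which
    \<open>low_pred\<close> identifies with Green's bound there.\<close>
  define L' where "L' = map (\<lambda>a. a - 1) (L m)"
  have L': "desc L'" "length L' \<le> m" "mval d L' = mlow d (L m)" for d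
    using L(1,2)[of m] m mval_map_pred[OF nonzero[of m]] m_less
    by (auto simp: L'_def sorted_wrt_map intro: sorted_wrt_mono_rel[rotated])
  \<comment> \<open>\<open>L m\<close> may have m entries, one too many for degree m - 1;
    \<open>low_mval\<close> includes this case.\<close>
  have low_pred: "low (m - 1) (H (m - 1)) = mlow (m - 1) (L m)"
    using descend[of m] low_mval(1)[of "m - 1" "L m"] L(1,2)[of m] m by simp
  have "for_general_linear_form n (\<lambda>h. codim n (m - 1) (restr n (m - 1) (I \<inter> homog n (m - 1)) h) \<le>
      low (m - 1) (codim n (m - 1) (I \<inter> homog n (m - 1))))"
    using m by (intro green_restriction graded_subspace_piece ideal) auto
  from for_general_conj[OF this m(2)[unfolded gen_def]] have "gen (m - 1)"
    unfolding gen_def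
  proof (rule for_general_mono)
    fix a :: "nat \<Rightarrow> 'k"
    define h where "h = linear_form n a"
    have h: "h \<in> homog n 1" unfolding h_def by (rule linear_form_homog)
    assume *: "codim n (m - 1) (restr n (m - 1) (I \<inter> homog n (m - 1)) (linear_form n a)) \<le>
      low (m - 1) (codim n (m - 1) (I \<inter> homog n (m - 1))) \<and> (\<forall>t\<ge>m. HJ (linear_form n a) t = low t (H t))"
    then have upper: "HJ h (m - 1) \<le> low (m - 1) (H (m - 1))"
      using add_principal_piece[OF I(1) h, of "m - 1"] m by (simp add: HJ_def H_def hilbert_eq_codim h_def)
    have "HJ h m = mval m L'" using * L(4)[of m] L'(3)[of m] m by (simp add: h_def)
    then have "expansion m (HJ h m) = L'" using L' m by (intro expansion_eq) auto
    moreover have "ideal_in n (add_principal n I h)"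
      using ideal h homog_subset_polys by (intro ideal_in_add_principal) auto
    ultimately have "mval (m - 1) L' \<le> HJ h (m - 1)"
      using hilbert_macaulay[of n "add_principal n I h" m] m by (simp add: HJ_def)
    with upper low_pred L'(3) have eq: "HJ h (m - 1) = low (m - 1) (H (m - 1))" by simp
    show "\<forall>t\<ge>m - 1. HJ (linear_form n a) t = low t (H t)"
    proof (intro allI impI)
      fix t assume "t \<ge> m - 1"
      then consider "t = m - 1" | "t \<ge> m" by linarith
      then show "HJ (linear_form n a) t = low t (H t)" using eq * by cases (simp_all add: h_def)
    qed
  qed
  with m have "m \<le> m - 1" unfolding m_Least by (intro Least_le) auto
  with m show False by simp
qed

end
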